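(* There is a polynomial $P$ in two variables such that the following holds. Let $d\ge1$ and $k\ge2$ be integers, $\epsilon>0$, and $\mathbf{u}_0\in\mathbb{R}^d$ with $\|\mathbf{u}_0\|^2=\frac{12}{\pi^2}k^2$. Run projected gradient descent with respect to the weight-sharing objective $F^{(1,k)}:\mathbb{R}^d\to\mathbb{R}$ (defined in the context), with a suitable constant learning rate $\eta>0$ (which may depend on $k$ and $\epsilon$), started from a point $\mathbf{w}_0^{(0)}$ with $\langle\mathbf{w}_0^{(0)},\mathbf{u}_0\rangle>0$ and $\|\mathbf{w}_0^{(0)}\|\le\|\mathbf{u}_0\|$. Then after some number $T\le P(k,1/\epsilon)$ of iterations, $\|\mathbf{w}_0^{(T)}-\mathbf{u}_0\|\le\epsilon$.
   Context: Let $\sigma=\mathrm{erf}$, $\mathrm{erf}(x)=\frac{1}{\sqrt{\pi}}\int_{-x}^{x}e^{-t^2}\,dt$. For $\mathbf{x}=(\mathbf{x}_1,\ldots,\mathbf{x}_k)\in(\mathbb{R}^d)^k$ and a single shared weight vector $\mathbf{w}_0\in\mathbb{R}^d$, let $$p^{(1,k)}_{\mathbf{w}_0}(\mathbf{x})=\sigma(\mathbf{w}_0^\top\mathbf{x}_1)+\prod_{l=1}^k\sigma(\mathbf{w}_0^\top\mathbf{x}_l).$$ The weight-sharing (WS) objective is $$F^{(1,k)}(\mathbf{w}_0)=\mathbb{E}_{\mathbf{x}}\left[\tfrac12\left(p^{(1,k)}_{\mathbf{w}_0}(\mathbf{x})-p^{(1,k)}_{\mathbf{u}_0}(\mathbf{x})\right)^2\right],\qquad\mathbf{w}_0\in\mathbb{R}^d,$$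 where $\mathbf{x}_1,\ldots,\mathbf{x}_k$ are i.i.d. standard Gaussian in $\mathbb{R}^d$. Projected gradient descent is the iteration $\mathbf{w}_0^{(t+1)}=\Pi\left(\mathbf{w}_0^{(t)}-\eta\nabla F^{(1,k)}(\mathbf{w}_0^{(t)})\right)$, where $\Pi$ is the Euclidean projection onto the ball $\{\mathbf{v}\in\mathbb{R}^d:\|\mathbf{v}\|\le\|\mathbf{u}_0\|\}$. *)

theory Defs
  imports "HOL-Probability.Probability" "HOL-Computational_Algebra.Polynomial"
begin

definition erf :: "real \<Rightarrow> real" where
  "erf x = 1 / sqrt pi * (LBINT t=-x..x. exp (- t\<^sup>2))"

text \<open>
  The dimension \<open>d\<close> is quantified inside the theorem, below the polynomial, so it
  cannot be a type parameter. The space \<open>\<real>\<^sup>d\<close> is the set of functions on \<open>{..<d}\<close>,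
  extended by \<open>undefined\<close>; this is also the space of the product measure used for the Gaussian.
\<close>

abbreviation Rn :: "nat \<Rightarrow> (nat \<Rightarrow> real) set" where
  "Rn d \<equiv> {..<d} \<rightarrow>\<^sub>E UNIV"

definition dotp :: "nat \<Rightarrow> (nat \<Rightarrow> real) \<Rightarrow> (nat \<Rightarrow> real) \<Rightarrow> real" where
  "dotp d v w = (\<Sum>i<d. v i * w i)"

definition vnorm :: "nat \<Rightarrow> (nat \<Rightarrow> real) \<Rightarrow> real" where
  "vnorm d v = L2_set v {..<d}"

definition vdist :: "nat \<Rightarrow> (nat \<Rightarrow> real) \<Rightarrow> (nat \<Rightarrow> real) \<Rightarrow> real" where
  "vdist d v w = vnorm d (\<lambda>i\<in>{..<d}. v i - w i)"

definition std_gaussian :: "nat \<Rightarrow> (nat \<Rightarrow> real) measure" where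
  "std_gaussian d = PiM {..<d} (\<lambda>_. density lborel std_normal_density)"

definition iid_gaussians :: "nat \<Rightarrow> nat \<Rightarrow> (nat \<Rightarrow> nat \<Rightarrow> real) measure" where
  "iid_gaussians d k = PiM {1..k} (\<lambda>_. std_gaussian d)"

definition ws_net ::
    "nat \<Rightarrow> nat \<Rightarrow> (nat \<Rightarrow> real) \<Rightarrow> (nat \<Rightarrow> nat \<Rightarrow> real) \<Rightarrow> real" where
  "ws_net d k w x = erf (dotp d w (x 1)) + (\<Prod>l=1..k. erf (dotp d w (x l)))"

definition ws_objective ::
    "nat \<Rightarrow> nat \<Rightarrow> (nat \<Rightarrow> real) \<Rightarrow> (nat \<Rightarrow> real) \<Rightarrow> real" where
  "ws_objective d k u w =
     (\<integral>x. 1 / 2 * (ws_net d k w x - ws_net d k u x)\<^sup>2 \<partial>iid_gaussians d k)"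

text \<open>The vector of partial derivatives.\<close>

definition grad :: "nat \<Rightarrow> ((nat \<Rightarrow> real) \<Rightarrow> real) \<Rightarrow> (nat \<Rightarrow> real) \<Rightarrow> (nat \<Rightarrow> real)" where
  "grad d F w = (\<lambda>i\<in>{..<d}. deriv (\<lambda>s. F (w(i := s))) (w i))"

text \<open>Same shape as \<^const>\<open>closest_point\<close>, whose type class excludes \<^typ>\<open>nat \<Rightarrow> real\<close>.\<close>

definition proj :: "nat \<Rightarrow> (nat \<Rightarrow> real) set \<Rightarrow> (nat \<Rightarrow> real) \<Rightarrow> (nat \<Rightarrow> real)" where
  "proj d S a = (SOME v. v \<in> S \<and> (\<forall>y\<in>S. vdist d a v \<le> vdist d a y))"

definition pgd_step ::
    "nat \<Rightarrow> nat \<Rightarrow> (nat \<Rightarrow> real) \<Rightarrow> real \<Rightarrow> (nat \<Rightarrow> real) \<Rightarrow> (nat \<Rightarrow> real)" where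
  "pgd_step d k u \<eta> w =
     proj d {v \<in> Rn d. vnorm d v \<le> vnorm d u}
       (\<lambda>i\<in>{..<d}. w i - \<eta> * grad d (ws_objective d k u) w i)"

definition pgd ::
    "nat \<Rightarrow> nat \<Rightarrow> (nat \<Rightarrow> real) \<Rightarrow> real \<Rightarrow> (nat \<Rightarrow> real) \<Rightarrow> nat \<Rightarrow> (nat \<Rightarrow> real)" where
  "pgd d k u \<eta> w t = (pgd_step d k u \<eta> ^^ t) w"

text \<open>Bivariate real polynomials are polynomials in one variable over \<^typ>\<open>real poly\<close>.\<close>

definition eval2 :: "real poly poly \<Rightarrow> real \<Rightarrow> real \<Rightarrow> real" where
  "eval2 P a b = poly (poly P [:a:]) b"

end

theory Submission
  imports Defs
begin

text \<open>
  Since \<open>erf\<close> is odd and \<open>k \<ge> 2\<close>, the mixed terms of the objective vanish, and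
  with \<open>A(w, v) = E[erf(w\<cdot>x) erf(v\<cdot>x)]\<close> and \<open>h(y) = y + y^k\<close> it equals
  \<open>h(A(w, w))/2 - h(A(w, u)) + h(A(u, u))/2\<close>. Writing \<open>erf\<close> as a Gaussian average of
  sines and integrating over \<open>x\<close> first gives the arcsine formula for \<open>A\<close>. Hence
  \<open>-\<nabla>F(w) = \<alpha> u - \<beta> w\<close> with explicit \<open>\<alpha> > 0\<close> and
  \<open>\<beta> \<ge> 0\<close> that depend only on \<open>|w|\<close>, \<open>|u|\<close> and \<open>w\<cdot>u\<close>.

  The inequality \<open>\<langle>-\<nabla>F(w), u - w\<rangle> > 0\<close> fails in general on the half ball, so the distance
  to \<open>u\<close> need not decrease from the start. But every step turns \<open>w\<close> towards \<open>u\<close>: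
  the component orthogonal to \<open>u\<close> is multiplied by \<open>1 - \<eta>\<beta>\<close>, the parallel one gains
  \<open>\<eta>\<alpha>|u|\<close> on top of that, and the projection onto the ball is a scaling. After polynomially
  many steps the angle is so small that the inequality does hold, with a polynomial margin as
  long as \<open>|w - u| \<ge> \<epsilon>\<close>, and from then on each step decreases \<open>|w - u|^2\<close> by a fixed amount.
\<close>

subsection \<open>The error function as a Gaussian average\<close>

abbreviation \<gamma> :: "real measure" where
  "\<gamma> \<equiv> std_normal_distribution"

text \<open>Parameter integrals over [0,1] are taken against a probability measure, so that Fubini
  exchanges them with Gaussian averages.\<close>

abbreviation unif01 :: "real measure" where
  "unif01 \<equiv> density lborel (indicat_real {0..1})"

lemma prob_space_gauss: "prob_space \<gamma>"
  by (rule prob_space_normal_density) simp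

lemma prob_space_unif01: "prob_space unif01"
proof
  show "emeasure unif01 (space unif01) = 1"
    by (simp add: emeasure_density ennreal_indicator)
qed

lemma integral_unif01:
  fixes f :: "real \<Rightarrow> real"
  assumes "continuous_on {0..1} f"
    and "\<And>t. 0 \<le> t \<Longrightarrow> t \<le> 1 \<Longrightarrow> (F has_real_derivative f t) (at t)"
    and [measurable]: "f \<in> borel_measurable borel"
  shows "integral\<^sup>L unif01 f = F 1 - F 0"
proof -
  have "integral\<^sup>L unif01 f = (\<integral>t. indicator {0..1} t *\<^sub>R f t \<partial>lborel)"
    by (subst integral_density) auto
  also have "\<dots> = F 1 - F 0"
    by (rule integral_FTC_atLeastAtMost)
      (use assms in \<open>auto simp: has_real_derivative_iff_has_vector_derivative
        intro: has_vector_derivative_at_within\<close>)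
  finally show ?thesis .
qed

lemma AE_unif01: "AE t in unif01. 0 \<le> t \<and> t \<le> 1"
  by (simp add: AE_density indicator_def)

lemma AE_gauss_nonzero: "AE z in \<gamma>. z \<noteq> 0"
  by (simp add: AE_density AE_lborel_singleton) (auto intro: AE_mp[OF AE_lborel_singleton[of 0]])

text \<open>With an antiderivative F of exp(-t^2), \<open>erf x\<close> is (F(x) - F(-x)) / sqrt pi,
  and both endpoints contribute the same amount to the derivative.\<close>

lemma erf_has_real_derivative:
  "(erf has_real_derivative 2 / sqrt pi * exp (- x\<^sup>2)) (at x)"
proof -
  have "\<exists>F. \<forall>x::real. -\<infinity> < ereal x \<longrightarrow> ereal x < \<infinity> \<longrightarrow>
      (F has_vector_derivative exp (- x\<^sup>2)) (at x)"
    by (rule einterval_antiderivative) auto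
  then obtain F :: "real \<Rightarrow> real"
    where "\<And>x. (F has_vector_derivative exp (- x\<^sup>2)) (at x)"
    by auto
  then have F: "(F has_real_derivative exp (- x\<^sup>2)) (at x)" for x
    by (simp add: has_real_derivative_iff_has_vector_derivative)
  have "erf = (\<lambda>x. 1 / sqrt pi * (F x - F (- x)))"
  proof
    fix x :: real
    have "(LBINT t=-x..x. exp (- t\<^sup>2)) = F x - F (- x)"
      by (rule interval_integral_FTC_finite)
        (auto intro!: continuous_intros has_vector_derivative_at_within
          F[unfolded has_real_derivative_iff_has_vector_derivative])
    then show "erf x = 1 / sqrt pi * (F x - F (- x))"
      by (simp add: erf_def)
  qed
  moreover have "((\<lambda>x. F (- x)) has_real_derivative exp (- (- x)\<^sup>2) * (- 1)) (at x)"
    by (rule DERIV_chain2[OF F]) (auto intro!: derivative_eq_intros)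
  then have "((\<lambda>x. 1 / sqrt pi * (F x - F (- x))) has_real_derivative
      1 / sqrt pi * (exp (- x\<^sup>2) - exp (- (- x)\<^sup>2) * (- 1))) (at x)"
    by (intro DERIV_cmult DERIV_diff F)
  ultimately show ?thesis
    by simp
qed

lemma erf_0 [simp]: "erf 0 = 0"
  by (simp add: erf_def interval_integral_endpoints_same zero_ereal_def[symmetric])

lemma erf_minus: "erf (- x) = - erf x"
  using interval_integral_endpoints_reverse[of "ereal (- x)" "ereal x" "\<lambda>t. exp (- t\<^sup>2)"]
  by (simp add: erf_def)

lemma borel_measurable_erf [measurable]: "erf \<in> borel_measurable borel"
  by (intro borel_measurable_continuous_onI DERIV_continuous_on[OF erf_has_real_derivative]
      has_field_derivative_at_within)

text \<open>For x >= 0 the value is the mass that the normal law of variance 1/2 gives to [-x, x];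
  oddness covers x < 0.\<close>

lemma abs_erf_le_1: "\<bar>erf x\<bar> \<le> 1"
proof -
  have *: "0 \<le> erf x \<and> erf x \<le> 1" if "x \<ge> 0" for x
  proof -
    have d: "normal_density 0 (1 / sqrt 2) t = exp (- t\<^sup>2) / sqrt pi" for t
      by (simp add: normal_density_def field_simps power_divide)
    have "erf x = (LBINT t:{-x..x}. normal_density 0 (1 / sqrt 2) t)"
      unfolding d using that by (simp add: erf_def interval_integral_Icc)
    also have "\<dots> = (\<integral>t. indicator {-x..x} t * normal_density 0 (1 / sqrt 2) t \<partial>lborel)"
      by (simp add: set_lebesgue_integral_def)
    finally have e: "erf x = \<dots>" .
    have "erf x \<le> (\<integral>t. normal_density 0 (1 / sqrt 2) t \<partial>lborel)"
      unfolding e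
      by (intro integral_mono integrable_real_mult_indicator[where f="normal_density 0 (1 / sqrt 2)", simplified mult.commute])
        (auto simp: indicator_def)
    moreover have "0 \<le> erf x"
      unfolding e by (intro integral_nonneg_AE) auto
    ultimately show ?thesis
      by simp
  qed
  show ?thesis
    using *[of x] *[of "-x"] erf_minus[of x] by (cases "x \<ge> 0") auto
qed

lemma integral_cos_gauss: "(\<integral>z. cos (t * z) \<partial>\<gamma>) = exp (- t\<^sup>2 / 2)"
proof -
  interpret prob_space \<gamma> by (rule prob_space_gauss)
  have "Re (char \<gamma> t) = (\<integral>z. Re (iexp (t * z)) \<partial>\<gamma>)"
    unfolding char_def
    by (rule integral_Re[symmetric]) (auto intro!: integrable_const_bound[where B=1])
  then show ?thesis
    by (simp add: char_std_normal_distribution Re_exp)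
qed

lemma integrable_bounded_prob:
  assumes "prob_space M" "f \<in> borel_measurable M" "\<And>x. \<bar>f x\<bar> \<le> (B::real)"
  shows "integrable M f"
proof -
  interpret prob_space M by fact
  show ?thesis using assms by (intro integrable_const_bound[where B=B]) auto
qed

text \<open>The integrand that represents \<open>erf\<close> as a Gaussian average over z. At z = 0
  the division convention gives 0 instead of the limit x; this point is a null set, and the bound by
  |x| holds there too.\<close>

definition sin_kernel :: "real \<Rightarrow> real \<Rightarrow> real" where
  "sin_kernel x z = sin (sqrt 2 * x * z) / (sqrt 2 * z)"

lemma abs_sin_kernel_le: "\<bar>sin_kernel x z\<bar> \<le> \<bar>x\<bar>"
proof (cases "z = 0")
  case False
  have "\<bar>sin (sqrt 2 * x * z)\<bar> \<le> \<bar>sqrt 2 * x * z\<bar>"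
    by (rule abs_sin_x_le_abs_x)
  then show ?thesis
    using False by (simp add: sin_kernel_def abs_mult field_simps)
qed (simp add: sin_kernel_def)

lemma measurable_sin_kernel [measurable]:
  "case_prod sin_kernel \<in> borel_measurable (borel \<Otimes>\<^sub>M borel)"
  unfolding sin_kernel_def by measurable

text \<open>\<open>erf x\<close> is the integral over t in [0,1] of the derivative of erf(x t). Its
  factor exp(-(x t)^2) is the Gaussian average of cos(sqrt 2 x t z) over z; after exchanging the
  integrals, the t integral of the cosine is the sine kernel.\<close>

lemma erf_eq_integral_sin_kernel: "erf x = 2 / sqrt pi * (\<integral>z. sin_kernel x z \<partial>\<gamma>)"
proof -
  interpret U: prob_space unif01 by (rule prob_space_unif01)
  interpret G: prob_space \<gamma> by (rule prob_space_gauss)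
  interpret P: pair_prob_space unif01 \<gamma> ..
  have int: "integrable (unif01 \<Otimes>\<^sub>M \<gamma>) (\<lambda>(t, z). x * cos (sqrt 2 * x * t * z))"
  proof (rule integrable_bounded_prob[where B="\<bar>x\<bar>"])
    show "\<bar>case p of (t, z) \<Rightarrow> x * cos (sqrt 2 * x * t * z)\<bar> \<le> \<bar>x\<bar>" for p
      by (auto simp: abs_mult mult_left_le abs_cos_le_one split: prod.split)
  qed (unfold_locales, measurable)
  have "erf x = (\<integral>t. x * (2 / sqrt pi * exp (- (x * t)\<^sup>2)) \<partial>unif01)"
  proof (subst integral_unif01[where F="\<lambda>t. erf (x * t)"])
    show "((\<lambda>t. erf (x * t)) has_real_derivative x * (2 / sqrt pi * exp (- (x * t)\<^sup>2))) (at t)" for t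
      by (rule DERIV_cong[OF DERIV_chain2[OF erf_has_real_derivative DERIV_cmult[OF DERIV_ident]]])
        simp
  qed (auto intro!: continuous_intros)
  also have "\<dots> = 2 / sqrt pi * (\<integral>t. x * exp (- (x * t)\<^sup>2) \<partial>unif01)"
    by (subst integral_mult_right_zero[symmetric]) (simp add: mult_ac)
  also have "(\<integral>t. x * exp (- (x * t)\<^sup>2) \<partial>unif01) =
      (\<integral>t. (\<integral>z. x * cos (sqrt 2 * x * t * z) \<partial>\<gamma>) \<partial>unif01)"
    using integral_cos_gauss[of "sqrt 2 * x * _"] by (simp add: power_mult_distrib mult_ac)
  also have "\<dots> = (\<integral>z. (\<integral>t. x * cos (sqrt 2 * x * t * z) \<partial>unif01) \<partial>\<gamma>)"
    by (rule P.Fubini_integral[symmetric, OF int])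
  also have "\<dots> = (\<integral>z. sin_kernel x z \<partial>\<gamma>)"
  proof (rule integral_cong_AE)
    show "AE z in \<gamma>. (\<integral>t. x * cos (sqrt 2 * x * t * z) \<partial>unif01) = sin_kernel x z"
      using AE_gauss_nonzero
    proof eventually_elim
      case (elim z)
      then show ?case
        by (subst integral_unif01[where F="\<lambda>t. sin (sqrt 2 * x * t * z) / (sqrt 2 * z)"])
          (auto intro!: continuous_intros derivative_eq_intros simp: sin_kernel_def field_simps)
    qed
  qed measurable
  finally show ?thesis .
qed

section \<open>Gaussian integrals of exponentials of quadratic forms\<close>

lemma has_bochner_integral_exp_quadratic_gauss:
  assumes "a > - 1 / 2"
  shows "has_bochner_integral \<gamma> (\<lambda>x. exp (- a * x\<^sup>2 + b * x))
    (exp (b\<^sup>2 / (2 * (1 + 2 * a))) / sqrt (1 + 2 * a))"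
proof -
  define r where "r = 1 + 2 * a"
  have r: "r > 0" using assms by (simp add: r_def)
  have a: "a = (r - 1) / 2" by (simp add: r_def)
  \<comment> \<open>Completing the square turns the weighted integrand into \<open>?C\<close> times
    the normal density of mean b/r and variance 1/r.\<close>
  let ?d = "normal_density (b / r) (1 / sqrt r)"
  let ?C = "exp (b\<^sup>2 / (2 * r)) / sqrt r"
  have eq: "std_normal_density x * exp (- a * x\<^sup>2 + b * x) = ?C * ?d x" for x
  proof -
    have "- x\<^sup>2 / 2 + (- a * x\<^sup>2 + b * x) = b\<^sup>2 / (2 * r) + - (x - b / r)\<^sup>2 * r / 2"
      using r by (simp add: a field_simps power2_eq_square)
    then have "exp (- x\<^sup>2 / 2) * exp (- a * x\<^sup>2 + b * x) =
        exp (b\<^sup>2 / (2 * r)) * exp (- (x - b / r)\<^sup>2 * r / 2)"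
      by (simp only: exp_add[symmetric])
    then show ?thesis
      using r by (simp add: normal_density_def real_sqrt_divide power_divide real_sqrt_mult
        field_simps)
  qed
  have "has_bochner_integral lborel ?d 1"
    using r by (simp add: has_bochner_integral_iff)
  from has_bochner_integral_mult_right[OF this, of ?C]
  have "has_bochner_integral lborel (\<lambda>x. std_normal_density x *\<^sub>R exp (- a * x\<^sup>2 + b * x)) ?C"
    unfolding real_scaleR_def eq by simp
  then show ?thesis
    unfolding r_def by (intro has_bochner_integral_density) auto
qed

text \<open>The condition on g makes the quadratic form in the exponent negative semidefinite. The
  constant bound gives integrability against probability measures.\<close>

lemma exp_quadratic_le_1:
  fixes g s S y z :: real
  assumes "s \<ge> 0" "S \<ge> 0" "g\<^sup>2 \<le> s * S"
  shows "exp (- s * y\<^sup>2 - S * z\<^sup>2 + 2 * g * y * z) \<le> 1"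
proof -
  have "\<bar>g\<bar> \<le> sqrt s * sqrt S"
    using real_sqrt_le_mono[OF assms(3)] by (simp add: real_sqrt_mult)
  then have "\<bar>g\<bar> * \<bar>y * z\<bar> \<le> sqrt s * sqrt S * \<bar>y * z\<bar>"
    by (rule mult_right_mono) simp
  then have "2 * g * y * z \<le> 2 * (sqrt s * \<bar>y\<bar>) * (sqrt S * \<bar>z\<bar>)"
    using abs_ge_self[of "g * (y * z)"] by (simp add: abs_mult mult_ac)
  also have "\<dots> \<le> (sqrt s * \<bar>y\<bar>)\<^sup>2 + (sqrt S * \<bar>z\<bar>)\<^sup>2"
    by (rule sum_squares_bound)
  also have "\<dots> = s * y\<^sup>2 + S * z\<^sup>2"
    using assms by (simp add: power_mult_distrib)
  finally show ?thesis by simp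
qed

lemma pair_prob_gauss: "pair_prob_space \<gamma> \<gamma>"
proof -
  interpret G: prob_space \<gamma> by (rule prob_space_gauss)
  show ?thesis ..
qed

lemma prob_space_pair_gauss: "prob_space (\<gamma> \<Otimes>\<^sub>M \<gamma>)"
proof -
  interpret pair_prob_space \<gamma> \<gamma> by (rule pair_prob_gauss)
  show ?thesis by (rule P.prob_space_axioms)
qed

lemma integrable_exp_quadratic_gauss_pair:
  assumes "s \<ge> 0" "S \<ge> 0" "g\<^sup>2 \<le> s * S"
  shows "integrable (\<gamma> \<Otimes>\<^sub>M \<gamma>) (\<lambda>(y, z). exp (- s * y\<^sup>2 - S * z\<^sup>2 + 2 * g * y * z))"
  by (rule integrable_bounded_prob[where B=1])
    (use exp_quadratic_le_1[OF assms] prob_space_pair_gauss in \<open>auto split: prod.split\<close>)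

text \<open>The value is det^(-1/2) for the matrix with diagonal entries 1 + 2s, 1 + 2S and
  off-diagonal entries -2g. Integrating over z first leaves a one-dimensional Gaussian integral in y
  with coefficient \<open>?a\<close>.\<close>

lemma integral_exp_quadratic_gauss_pair:
  assumes "s \<ge> 0" "S \<ge> 0" "g\<^sup>2 \<le> s * S"
  shows "(\<integral>(y, z). exp (- s * y\<^sup>2 - S * z\<^sup>2 + 2 * g * y * z) \<partial>(\<gamma> \<Otimes>\<^sub>M \<gamma>)) =
    1 / sqrt ((1 + 2 * s) * (1 + 2 * S) - 4 * g\<^sup>2)"
proof -
  interpret pair_prob_space \<gamma> \<gamma> by (rule pair_prob_gauss)
  let ?a = "s - 2 * g\<^sup>2 / (1 + 2 * S)"
  have pos: "1 + 2 * S > 0" using assms by simp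
  have "2 * g\<^sup>2 \<le> s * (1 + 2 * S)"
    using assms by (simp add: algebra_simps)
  then have a: "?a > - 1 / 2" "?a \<ge> 0"
    using pos by (auto simp: field_simps)
  have "(\<integral>(y, z). exp (- s * y\<^sup>2 - S * z\<^sup>2 + 2 * g * y * z) \<partial>(\<gamma> \<Otimes>\<^sub>M \<gamma>)) =
      (\<integral>y. (\<integral>z. exp (- s * y\<^sup>2 - S * z\<^sup>2 + 2 * g * y * z) \<partial>\<gamma>) \<partial>\<gamma>)"
    using integral_fst'[OF integrable_exp_quadratic_gauss_pair[OF assms]] by simp
  also have "\<dots> = (\<integral>y. exp (- ?a * y\<^sup>2 + 0 * y) / sqrt (1 + 2 * S) \<partial>\<gamma>)"
  proof (rule Bochner_Integration.integral_cong)
    fix y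
    have "(\<integral>z. exp (- s * y\<^sup>2 - S * z\<^sup>2 + 2 * g * y * z) \<partial>\<gamma>) =
        (\<integral>z. exp (- s * y\<^sup>2) * exp (- S * z\<^sup>2 + (2 * g * y) * z) \<partial>\<gamma>)"
      by (simp add: exp_add[symmetric] algebra_simps)
    also have "\<dots> = exp (- s * y\<^sup>2) * (exp ((2 * g * y)\<^sup>2 / (2 * (1 + 2 * S))) / sqrt (1 + 2 * S))"
      using has_bochner_integral_integral_eq[OF has_bochner_integral_exp_quadratic_gauss[of S "2 * g * y"]]
        assms by simp
    also have "\<dots> = exp (- s * y\<^sup>2 + (2 * g * y)\<^sup>2 / (2 * (1 + 2 * S))) / sqrt (1 + 2 * S)"
      by (simp only: exp_add times_divide_eq_right)
    also have "- s * y\<^sup>2 + (2 * g * y)\<^sup>2 / (2 * (1 + 2 * S)) = - ?a * y\<^sup>2 + 0 * y"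
      using pos by (simp add: field_simps power2_eq_square)
    finally show "(\<integral>z. exp (- s * y\<^sup>2 - S * z\<^sup>2 + 2 * g * y * z) \<partial>\<gamma>) =
      exp (- ?a * y\<^sup>2 + 0 * y) / sqrt (1 + 2 * S)" .
  qed simp
  also have "\<dots> = 1 / sqrt (1 + 2 * ?a) / sqrt (1 + 2 * S)"
    using has_bochner_integral_integral_eq[OF has_bochner_integral_exp_quadratic_gauss[OF a(1), of 0]]
    by simp
  also have "\<dots> = 1 / sqrt ((1 + 2 * ?a) * (1 + 2 * S))"
    by (simp add: real_sqrt_mult)
  also have "(1 + 2 * ?a) * (1 + 2 * S) = (1 + 2 * s) * (1 + 2 * S) - 4 * g\<^sup>2"
    using pos by (simp add: field_simps)
  finally show ?thesis .
qed

subsection \<open>Gaussian correlations of the error function\<close>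

lemma prob_space_std_gaussian: "prob_space (std_gaussian d)"
  unfolding std_gaussian_def by (intro prob_space_PiM prob_space_gauss)

lemma measurable_dotp [measurable]: "dotp d w \<in> borel_measurable (std_gaussian d)"
  unfolding std_gaussian_def dotp_def[abs_def] by measurable

lemma dotp_commute: "dotp d v w = dotp d w v"
  by (simp add: dotp_def mult.commute)

lemma dotp_self_nonneg: "dotp d w w \<ge> 0"
  by (auto simp: dotp_def intro: sum_nonneg)

lemma dotp_lincomb: "dotp d (\<lambda>i. a * v i + b * w i) x = a * dotp d v x + b * dotp d w x"
  by (simp add: dotp_def sum.distrib sum_distrib_left algebra_simps)

lemma Cauchy_Schwarz_dotp: "(dotp d v w)\<^sup>2 \<le> dotp d v v * dotp d w w"
  using Cauchy_Schwarz_ineq_sum[of v w "{..<d}"] by (simp add: dotp_def power2_eq_square)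

text \<open>Real and imaginary parts of the characteristic function, which factors over the
  independent coordinates.\<close>

lemma integral_cos_dotp: "(\<integral>x. cos (dotp d a x) \<partial>std_gaussian d) = exp (- dotp d a a / 2)"
  and integral_sin_dotp: "(\<integral>x. sin (dotp d a x) \<partial>std_gaussian d) = 0"
proof -
  interpret prob_space "std_gaussian d" by (rule prob_space_std_gaussian)
  interpret G: prob_space \<gamma> by (rule prob_space_gauss)
  interpret product_sigma_finite "\<lambda>_::nat. \<gamma>" ..
  have "(\<integral>x. iexp (dotp d a x) \<partial>std_gaussian d) = (\<integral>x. (\<Prod>i<d. iexp (a i * x i)) \<partial>std_gaussian d)"
    by (simp add: dotp_def sum_distrib_left exp_sum)
  also have "\<dots> = (\<Prod>i<d. (\<integral>x. iexp (a i * x) \<partial>\<gamma>))"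
    unfolding std_gaussian_def
    by (rule product_integral_prod) (auto intro!: G.integrable_const_bound[where B=1])
  also have "\<dots> = (\<Prod>i<d. complex_of_real (exp (- (a i)\<^sup>2 / 2)))"
    using char_std_normal_distribution by (simp add: char_def fun_eq_iff)
  also have "\<dots> = complex_of_real (exp (- dotp d a a / 2))"
    by (simp add: of_real_prod[symmetric] exp_sum[symmetric] dotp_def power2_eq_square
        sum_negf sum_divide_distrib del: of_real_exp of_real_prod)
  finally have "(\<integral>x. iexp (dotp d a x) \<partial>std_gaussian d) = \<dots>" .
  moreover have "Re (\<integral>x. iexp (dotp d a x) \<partial>std_gaussian d) = (\<integral>x. cos (dotp d a x) \<partial>std_gaussian d)"
    by (subst integral_Re[symmetric])
      (auto simp: Re_exp intro!: integrable_const_bound[where B=1])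
  moreover have "Im (\<integral>x. iexp (dotp d a x) \<partial>std_gaussian d) = (\<integral>x. sin (dotp d a x) \<partial>std_gaussian d)"
    by (subst integral_Im[symmetric])
      (auto simp: Im_exp intro!: integrable_const_bound[where B=1])
  ultimately show "(\<integral>x. cos (dotp d a x) \<partial>std_gaussian d) = exp (- dotp d a a / 2)"
    "(\<integral>x. sin (dotp d a x) \<partial>std_gaussian d) = 0"
    by simp_all
qed

text \<open>A product of two sines is half the difference of the cosines of two linear forms in x,
  whose squared lengths differ only in the sign of the cross term. For y = 0 or z = 0 both sides are
  0.\<close>

lemma integral_sin_kernel_mult:
  "(\<integral>x. sin_kernel (dotp d w x) y * sin_kernel (dotp d v x) z \<partial>std_gaussian d) =
    (exp (- dotp d w w * y\<^sup>2 - dotp d v v * z\<^sup>2 + 2 * dotp d w v * y * z) -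
     exp (- dotp d w w * y\<^sup>2 - dotp d v v * z\<^sup>2 + 2 * (- dotp d w v) * y * z)) / (4 * y * z)"
    (is "?L = (exp ?P - exp ?Q) / _")
proof -
  define lc where "lc b i = sqrt 2 * y * w i + b * z * v i" for b i
  have lc: "dotp d (lc b) x = sqrt 2 * y * dotp d w x + b * z * dotp d v x" for b x
    unfolding lc_def by (rule dotp_lincomb)
  have lc2: "dotp d (lc b) (lc b) = 2 * y\<^sup>2 * dotp d w w + 2 * sqrt 2 * b * y * z * dotp d w v
      + b\<^sup>2 * z\<^sup>2 * dotp d v v" for b
    unfolding lc[of b "lc b"] dotp_commute[of d w "lc b"] dotp_commute[of d v "lc b"] lc
    by (simp add: dotp_commute[of d v w] power2_eq_square algebra_simps)
  have int: "integrable (std_gaussian d) (\<lambda>x. cos (dotp d a x))" for a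
    by (rule integrable_bounded_prob[where B=1]) (auto intro: prob_space_std_gaussian)
  have "?L = (\<integral>x. (cos (dotp d (lc (- sqrt 2)) x) - cos (dotp d (lc (sqrt 2)) x)) / (4 * y * z) \<partial>std_gaussian d)"
    by (rule Bochner_Integration.integral_cong)
      (simp_all add: sin_kernel_def lc cos_add cos_diff mult_ac field_simps)
  also have "\<dots> = (exp (- dotp d (lc (- sqrt 2)) (lc (- sqrt 2)) / 2)
      - exp (- dotp d (lc (sqrt 2)) (lc (sqrt 2)) / 2)) / (4 * y * z)"
    by (simp add: int integral_cos_dotp)
  also have "- dotp d (lc (- sqrt 2)) (lc (- sqrt 2)) / 2 = ?P"
    by (simp add: lc2 field_simps)
  also have "- dotp d (lc (sqrt 2)) (lc (sqrt 2)) / 2 = ?Q"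
    by (simp add: lc2 field_simps)
  finally show ?thesis .
qed

text \<open>The absolute value of this product dominates the product of two sine kernels, uniformly
  in y and z, which justifies Fubini in \<open>integral_erf_mult\<close>.\<close>

lemma integrable_dotp_mult: "integrable (std_gaussian d) (\<lambda>x. dotp d w x * dotp d v x)"
proof -
  interpret prob_space "std_gaussian d" by (rule prob_space_std_gaussian)
  interpret G: prob_space \<gamma> by (rule prob_space_gauss)
  interpret product_sigma_finite "\<lambda>_::nat. \<gamma>" ..
  have 1: "integrable (std_gaussian d) (\<lambda>x. x i * x j)" if "i < d" "j < d" for i j
  proof -
    \<comment> \<open>Writing x_i x_j as a product over all coordinates covers equal and distinct
      indices at once: each factor is a moment of order 0, 1 or 2.\<close>
    let ?f = "\<lambda>l x. (if l = i then x else 1) * (if l = j then x else (1::real))"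
    have "integrable (std_gaussian d) (\<lambda>x. \<Prod>l<d. ?f l (x l))"
      unfolding std_gaussian_def
    proof (rule product_integrable_prod)
      fix l
      consider "?f l = (\<lambda>x. x ^ 0)" | "?f l = (\<lambda>x. x ^ 1)" | "?f l = (\<lambda>x. x ^ 2)"
        by (cases "l = i"; cases "l = j") (auto simp: power2_eq_square fun_eq_iff)
      then show "integrable \<gamma> (?f l)"
        by cases (use integrable_std_normal_distribution_moment in metis)+
    qed simp
    then show ?thesis
      using that by (simp add: prod.distrib prod.delta)
  qed
  have "integrable (std_gaussian d) (\<lambda>x. \<Sum>i<d. \<Sum>j<d. (w i * v j) * (x i * x j))"
    by (intro Bochner_Integration.integrable_sum integrable_mult_right 1) auto
  also have "(\<lambda>x. \<Sum>i<d. \<Sum>j<d. (w i * v j) * (x i * x j)) = (\<lambda>x. dotp d w x * dotp d v x)"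
    unfolding dotp_def sum_product by (intro ext sum.cong refl) (simp only: mult_ac)
  finally show ?thesis .
qed

lemma integral_arcsin_kernel:
  assumes "a > 0" "c\<^sup>2 < a"
  shows "(\<integral>t. c / sqrt (a - (c * t)\<^sup>2) \<partial>unif01) = arcsin (c / sqrt a)"
proof -
  have pos: "a - (c * t)\<^sup>2 > 0" if "0 \<le> t" "t \<le> 1" for t
  proof -
    have "t\<^sup>2 \<le> 1"
      using that by (simp add: power_le_one)
    then have "c\<^sup>2 * t\<^sup>2 \<le> c\<^sup>2"
      by (simp add: mult_left_le)
    then show ?thesis
      using assms by (simp add: power_mult_distrib)
  qed
  have "((\<lambda>t. arcsin (c * t / sqrt a)) has_real_derivative c / sqrt (a - (c * t)\<^sup>2)) (at t)"
    if t: "0 \<le> t" "t \<le> 1" for t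
  proof -
    have "(c * t / sqrt a)\<^sup>2 < 1"
      using pos[OF t] assms by (simp add: power_divide)
    then have "\<bar>c * t / sqrt a\<bar> < 1"
      by (simp add: abs_square_less_1)
    moreover have "1 - (c * t / sqrt a)\<^sup>2 = (a - (c * t)\<^sup>2) / a"
      using assms by (simp add: power_divide field_simps)
    ultimately have "inverse (sqrt (1 - (c * t / sqrt a)\<^sup>2)) * (c / sqrt a) = c / sqrt (a - (c * t)\<^sup>2)"
      using assms by (simp add: real_sqrt_divide)
    moreover have "(arcsin has_real_derivative inverse (sqrt (1 - (c * t / sqrt a)\<^sup>2))) (at (c * t / sqrt a))"
      using \<open>\<bar>c * t / sqrt a\<bar> < 1\<close> by (intro DERIV_arcsin) linarith+
    moreover have "((\<lambda>t. c * t / sqrt a) has_real_derivative c / sqrt a) (at t)"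
      using DERIV_cmult[OF DERIV_ident, of "c / sqrt a" t] by simp
    ultimately show ?thesis
      using DERIV_chain2 by metis
  qed
  moreover have "continuous_on {0..1} (\<lambda>t. c / sqrt (a - (c * t)\<^sup>2))"
    using pos by (force intro!: continuous_intros)
  ultimately show ?thesis
    by (subst integral_unif01[where F="\<lambda>t. arcsin (c * t / sqrt a)"]) auto
qed

text \<open>Both factors become averages of sine kernels over Gaussian y and z. Integrating over x
  first gives a difference of exponentials with couplings c and -c, which is an integral over t in
  [0,1] of exponentials with couplings c t and -c t. Their integral over (y, z) is the inverse root
  of a determinant, and the t integral of that is the arcsine.\<close>

lemma integral_erf_mult:
  "(\<integral>x. erf (dotp d w x) * erf (dotp d v x) \<partial>std_gaussian d) =
    2 / pi * arcsin (2 * dotp d w v / sqrt ((1 + 2 * dotp d w w) * (1 + 2 * dotp d v v)))"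
proof -
  define s S c where "s = dotp d w w" and "S = dotp d v v" and "c = dotp d w v"
  have sS: "s \<ge> 0" "S \<ge> 0" "c\<^sup>2 \<le> s * S"
    by (simp_all add: s_def S_def c_def dotp_self_nonneg Cauchy_Schwarz_dotp)
  let ?M = "std_gaussian d" and ?P = "\<gamma> \<Otimes>\<^sub>M \<gamma>"
  interpret M: prob_space ?M by (rule prob_space_std_gaussian)
  interpret U: prob_space unif01 by (rule prob_space_unif01)
  interpret G: prob_space \<gamma> by (rule prob_space_gauss)
  interpret GG: pair_prob_space \<gamma> \<gamma> ..
  interpret MP: pair_prob_space ?M ?P ..
  interpret PU: pair_prob_space ?P unif01 ..
  let ?K = "\<lambda>x (y, z). sin_kernel (dotp d w x) y * sin_kernel (dotp d v x) z"
  let ?E = "\<lambda>g (y, z). exp (- s * y\<^sup>2 - S * z\<^sup>2 + 2 * g * y * z)"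
  have K_le: "\<bar>?K x p\<bar> \<le> \<bar>dotp d w x * dotp d v x\<bar>" for x p
    by (auto simp: abs_mult intro!: mult_mono abs_sin_kernel_le split: prod.split)
  have intK: "integrable ?P (?K x)" for x
    by (rule integrable_bounded_prob[OF prob_space_pair_gauss _ K_le]) measurable
  have intMP: "integrable (?M \<Otimes>\<^sub>M ?P) (case_prod ?K)"
  proof (rule MP.Fubini_integrable)
    show meas: "case_prod ?K \<in> borel_measurable (?M \<Otimes>\<^sub>M ?P)"
      by measurable
    show "integrable ?M (\<lambda>x. \<integral>p. norm (case_prod ?K (x, p)) \<partial>?P)"
    proof (rule Bochner_Integration.integrable_bound[OF integrable_dotp_mult[of d w v]])
      show "AE x in ?M. norm (\<integral>p. norm (case_prod ?K (x, p)) \<partial>?P) \<le> norm (dotp d w x * dotp d v x)"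
      proof (rule AE_I2)
        fix x
        have "(\<integral>p. norm (?K x p) \<partial>?P) \<le> (\<integral>p. \<bar>dotp d w x * dotp d v x\<bar> \<partial>?P)"
          by (intro integral_mono integrable_norm intK) (auto simp: K_le)
        then show "norm (\<integral>p. norm (case_prod ?K (x, p)) \<partial>?P) \<le> norm (dotp d w x * dotp d v x)"
          by (simp add: GG.P.prob_space)
      qed
    qed (use meas in measurable)
  qed (use intK in simp)
  \<comment> \<open>For couplings of absolute value at most |c| each exponential is at most 1, so
    the constant |c| dominates.\<close>
  have intPU: "integrable (?P \<Otimes>\<^sub>M unif01)
    (\<lambda>(p, t). c / 2 * (?E (c * t) p + ?E (- (c * t)) p))"
  proof (rule PU.Fubini_integrable)
    have le: "?E g p \<le> 1" if "g\<^sup>2 \<le> s * S" for g p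
      using exp_quadratic_le_1[OF sS(1,2) that] by (simp split: prod.split)
    have ct: "(c * t)\<^sup>2 \<le> s * S" if "0 \<le> t" "t \<le> 1" for t
      using sS(3) that
      by (simp add: power_mult_distrib)
        (meson mult_left_le order_trans power_le_one zero_le_power2)
    have AE: "AE t in unif01. norm (c / 2 * (?E (c * t) p + ?E (- (c * t)) p)) \<le> norm c" for p
      using AE_unif01
    proof eventually_elim
      case (elim t)
      then have "?E (c * t) p + ?E (- (c * t)) p \<le> 2"
        using le[of "c * t" p] le[of "- (c * t)" p] ct[of t] by (simp del: mult_minus_right)
      moreover have "0 \<le> ?E (c * t) p + ?E (- (c * t)) p"
        by (simp split: prod.split)
      ultimately have "\<bar>c\<bar> / 2 * (?E (c * t) p + ?E (- (c * t)) p) \<le> \<bar>c\<bar> / 2 * 2"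
        by (intro mult_left_mono) auto
      then show ?case
        using \<open>0 \<le> ?E (c * t) p + ?E (- (c * t)) p\<close> by (simp add: abs_mult)
    qed
    have int: "integrable unif01 (\<lambda>t. c / 2 * (?E (c * t) p + ?E (- (c * t)) p))" for p
      by (rule U.integrable_const_bound[OF AE]) measurable
    show "AE p in ?P. integrable unif01 (\<lambda>t. (\<lambda>(p, t). c / 2 * (?E (c * t) p + ?E (- (c * t)) p)) (p, t))"
      using int by simp
    show "(\<lambda>(p, t). c / 2 * (?E (c * t) p + ?E (- (c * t)) p)) \<in> borel_measurable (?P \<Otimes>\<^sub>M unif01)"
      by measurable
    show "integrable ?P (\<lambda>p. \<integral>t. norm ((\<lambda>(p, t). c / 2 * (?E (c * t) p + ?E (- (c * t)) p)) (p, t)) \<partial>unif01)"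
    proof (rule GG.P.integrable_const_bound[where B="norm c"])
      show "AE p in ?P. norm (\<integral>t. norm ((\<lambda>(p, t). c / 2 * (?E (c * t) p + ?E (- (c * t)) p)) (p, t)) \<partial>unif01) \<le> norm c"
      proof (rule AE_I2)
        fix p
        have "(\<integral>t. norm (c / 2 * (?E (c * t) p + ?E (- (c * t)) p)) \<partial>unif01) \<le> (\<integral>t. norm c \<partial>unif01)"
          by (rule integral_mono_AE[OF integrable_norm[OF int] _ AE]) simp
        then show "norm (\<integral>t. norm ((\<lambda>(p, t). c / 2 * (?E (c * t) p + ?E (- (c * t)) p)) (p, t)) \<partial>unif01) \<le> norm c"
          using U.prob_space by simp
      qed
    qed measurable
  qed
  have "(\<integral>x. erf (dotp d w x) * erf (dotp d v x) \<partial>?M) = (\<integral>x. 4 / pi * (\<integral>p. ?K x p \<partial>?P) \<partial>?M)"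
  proof (rule Bochner_Integration.integral_cong)
    fix x
    have "(\<integral>p. ?K x p \<partial>?P) = (\<integral>y. (\<integral>z. sin_kernel (dotp d w x) y * sin_kernel (dotp d v x) z \<partial>\<gamma>) \<partial>\<gamma>)"
      using GG.integral_fst'[OF intK, of x] by simp
    also have "\<dots> = (\<integral>y. sin_kernel (dotp d w x) y \<partial>\<gamma>) * (\<integral>z. sin_kernel (dotp d v x) z \<partial>\<gamma>)"
      by simp
    finally show "erf (dotp d w x) * erf (dotp d v x) = 4 / pi * (\<integral>p. ?K x p \<partial>?P)"
      by (simp add: erf_eq_integral_sin_kernel)
  qed simp
  also have "\<dots> = 4 / pi * (\<integral>p. (\<integral>x. ?K x p \<partial>?M) \<partial>?P)"
    using MP.Fubini_integral[OF intMP] by simp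
  also have "(\<integral>p. (\<integral>x. ?K x p \<partial>?M) \<partial>?P) =
      (\<integral>p. (\<integral>t. c / 2 * (?E (c * t) p + ?E (- (c * t)) p) \<partial>unif01) \<partial>?P)"
  proof (rule integral_cong_AE)
    \<comment> \<open>The antiderivative in t divides by 4 y z, so the axes, a null set, are
      excluded.\<close>
    have "AE p in ?P. fst p \<noteq> 0 \<and> snd p \<noteq> 0"
    proof (rule GG.AE_pair_measure)
      show "AE x in \<gamma>. AE y in \<gamma>. fst (x, y) \<noteq> 0 \<and> snd (x, y) \<noteq> 0"
        using AE_gauss_nonzero
      proof eventually_elim
        case (elim y)
        show ?case using AE_gauss_nonzero by eventually_elim (use elim in simp)
      qed
    qed measurable
    then show "AE p in ?P. (\<integral>x. ?K x p \<partial>?M) =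
      (\<integral>t. c / 2 * (?E (c * t) p + ?E (- (c * t)) p) \<partial>unif01)"
    proof eventually_elim
      case (elim p)
      obtain y z where p: "p = (y, z)" by (cases p)
      have nz: "y \<noteq> 0" "z \<noteq> 0" using elim p by auto
      have D: "((\<lambda>t. ?E (b * t) (y, z) / (4 * y * z)) has_real_derivative b / 2 * ?E (b * t) (y, z)) (at t)" for t b
        using nz by (auto intro!: derivative_eq_intros)
      have "(\<integral>x. ?K x p \<partial>?M) = (?E c (y, z) - ?E (- c) (y, z)) / (4 * y * z)"
        by (simp add: p integral_sin_kernel_mult s_def S_def c_def)
      also have "\<dots> = (\<integral>t. c / 2 * (?E (c * t) (y, z) + ?E (- (c * t)) (y, z)) \<partial>unif01)"
      proof (subst integral_unif01[where F="\<lambda>t. ?E (c * t) (y, z) / (4 * y * z) - ?E (- c * t) (y, z) / (4 * y * z)"])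
        show "((\<lambda>t. ?E (c * t) (y, z) / (4 * y * z) - ?E (- c * t) (y, z) / (4 * y * z))
          has_real_derivative c / 2 * (?E (c * t) (y, z) + ?E (- (c * t)) (y, z))) (at t)" for t
          using DERIV_diff[OF D[of c t] D[of "- c" t]] by (simp add: algebra_simps)
      qed (auto intro!: continuous_intros simp: diff_divide_distrib)
      finally show ?case by (simp add: p)
    qed
  qed measurable
  also have "\<dots> = (\<integral>t. (\<integral>p. c / 2 * (?E (c * t) p + ?E (- (c * t)) p) \<partial>?P) \<partial>unif01)"
    by (rule PU.Fubini_integral[symmetric, OF intPU])
  also have "\<dots> = (\<integral>t. 1 / 2 * (2 * c / sqrt ((1 + 2 * s) * (1 + 2 * S) - (2 * c * t)\<^sup>2)) \<partial>unif01)"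
  proof (rule integral_cong_AE)
    show "AE t in unif01. (\<integral>p. c / 2 * (?E (c * t) p + ?E (- (c * t)) p) \<partial>?P) =
      1 / 2 * (2 * c / sqrt ((1 + 2 * s) * (1 + 2 * S) - (2 * c * t)\<^sup>2))"
      using AE_unif01
    proof eventually_elim
      case (elim t)
      have "c\<^sup>2 * t\<^sup>2 \<le> c\<^sup>2"
        using elim by (intro mult_left_le) (auto simp: power_le_one)
      then have g: "(c * t)\<^sup>2 \<le> s * S" "(- (c * t))\<^sup>2 \<le> s * S"
        using sS(3) by (simp_all add: power_mult_distrib)
      have "(\<integral>p. c / 2 * (?E (c * t) p + ?E (- (c * t)) p) \<partial>?P) =
        c / 2 * ((\<integral>p. ?E (c * t) p \<partial>?P) + (\<integral>p. ?E (- (c * t)) p \<partial>?P))"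
        using integrable_exp_quadratic_gauss_pair[OF sS(1,2) g(1)]
          integrable_exp_quadratic_gauss_pair[OF sS(1,2) g(2)] by simp
      also have "\<dots> = c / sqrt ((1 + 2 * s) * (1 + 2 * S) - 4 * (c * t)\<^sup>2)"
        unfolding integral_exp_quadratic_gauss_pair[OF sS(1,2) g(1)]
          integral_exp_quadratic_gauss_pair[OF sS(1,2) g(2)] by simp
      finally show ?case by (simp add: power_mult_distrib)
    qed
  qed measurable
  also have "\<dots> = 1 / 2 * arcsin (2 * c / sqrt ((1 + 2 * s) * (1 + 2 * S)))"
  proof -
    \<comment> \<open>The extra term 1 + 2s + 2S makes the inequality strict and keeps the argument
      of the arcsine inside (-1, 1).\<close>
    have "4 * (s * S) < (1 + 2 * s) * (1 + 2 * S)"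
      using sS(1,2) by (simp add: algebra_simps)
    then have "(2 * c)\<^sup>2 < (1 + 2 * s) * (1 + 2 * S)"
      using sS(3) by (simp add: power_mult_distrib)
    then show ?thesis
      using sS(1,2) by (subst integral_mult_right_zero, subst integral_arcsin_kernel) (auto intro!: mult_pos_pos)
  qed
  finally show ?thesis
    by (simp add: s_def S_def c_def)
qed

text \<open>After the same exchange with a single kernel, the inner integral is that of the sine of
  a linear form, which is 0.\<close>

lemma integral_erf: "(\<integral>x. erf (dotp d w x) \<partial>std_gaussian d) = 0"
proof -
  interpret M: prob_space "std_gaussian d" by (rule prob_space_std_gaussian)
  interpret G: prob_space \<gamma> by (rule prob_space_gauss)
  interpret MG: pair_prob_space "std_gaussian d" \<gamma> ..
  let ?K = "\<lambda>x y. sin_kernel (dotp d w x) y"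
  have intK: "integrable \<gamma> (?K x)" for x
    by (rule integrable_bounded_prob[OF prob_space_gauss _ abs_sin_kernel_le]) measurable
  have intd: "integrable (std_gaussian d) (dotp d w)"
    by (rule M.square_integrable_imp_integrable[OF measurable_dotp])
      (simp only: power2_eq_square integrable_dotp_mult)
  have int: "integrable (std_gaussian d \<Otimes>\<^sub>M \<gamma>) (case_prod ?K)"
  proof (rule MG.Fubini_integrable)
    show meas: "case_prod ?K \<in> borel_measurable (std_gaussian d \<Otimes>\<^sub>M \<gamma>)"
      by measurable
    show "integrable (std_gaussian d) (\<lambda>x. \<integral>y. norm (case_prod ?K (x, y)) \<partial>\<gamma>)"
    proof (rule Bochner_Integration.integrable_bound[OF intd])
      show "AE x in std_gaussian d. norm (\<integral>y. norm (case_prod ?K (x, y)) \<partial>\<gamma>) \<le> norm (dotp d w x)"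
      proof (rule AE_I2)
        fix x
        have "(\<integral>y. norm (?K x y) \<partial>\<gamma>) \<le> (\<integral>y. \<bar>dotp d w x\<bar> \<partial>\<gamma>)"
          by (intro integral_mono integrable_norm intK) (auto simp: abs_sin_kernel_le)
        then show "norm (\<integral>y. norm (case_prod ?K (x, y)) \<partial>\<gamma>) \<le> norm (dotp d w x)"
          using G.prob_space by simp
      qed
    qed (use meas in measurable)
  qed (use intK in simp)
  have "(\<integral>x. erf (dotp d w x) \<partial>std_gaussian d) =
      2 / sqrt pi * (\<integral>x. (\<integral>y. ?K x y \<partial>\<gamma>) \<partial>std_gaussian d)"
    by (simp add: erf_eq_integral_sin_kernel)
  also have "(\<integral>x. (\<integral>y. ?K x y \<partial>\<gamma>) \<partial>std_gaussian d) = (\<integral>y. (\<integral>x. ?K x y \<partial>std_gaussian d) \<partial>\<gamma>)"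
    by (rule MG.Fubini_integral[symmetric, OF int])
  also have "(\<lambda>y. \<integral>x. ?K x y \<partial>std_gaussian d) = (\<lambda>_. 0)"
  proof
    fix y
    have "sqrt 2 * dotp d w x * y = dotp d (\<lambda>i. (sqrt 2 * y) * w i + 0 * w i) x" for x
      unfolding dotp_lincomb by simp
    then show "(\<integral>x. ?K x y \<partial>std_gaussian d) = 0"
      unfolding sin_kernel_def by (simp add: integral_sin_dotp)
  qed
  finally show ?thesis by simp
qed

text \<open>The arcsine kernel: by \<open>integral_erf_mult\<close>, the correlation of erf(w.x) and
  erf(v.x) under a standard Gaussian x.\<close>

definition erf_corr :: "nat \<Rightarrow> (nat \<Rightarrow> real) \<Rightarrow> (nat \<Rightarrow> real) \<Rightarrow> real" where
  "erf_corr d w v =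
    2 / pi * arcsin (2 * dotp d w v / sqrt ((1 + 2 * dotp d w w) * (1 + 2 * dotp d v v)))"

section \<open>Closed form of the objective through independence of the patches\<close>

lemma
  fixes f :: "nat \<Rightarrow> (nat \<Rightarrow> real) \<Rightarrow> real"
  assumes "\<And>l. f l \<in> borel_measurable (std_gaussian d)" "\<And>l x. \<bar>f l x\<bar> \<le> 1"
  shows integrable_prod_iid: "integrable (iid_gaussians d k) (\<lambda>x. \<Prod>l=1..k. f l (x l))"
    and integral_prod_iid: "(\<integral>x. (\<Prod>l=1..k. f l (x l)) \<partial>iid_gaussians d k) =
      (\<Prod>l=1..k. integral\<^sup>L (std_gaussian d) (f l))"
proof -
  interpret prob_space "std_gaussian d" by (rule prob_space_std_gaussian)
  interpret product_sigma_finite "\<lambda>_::nat. std_gaussian d" ..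
  have "integrable (std_gaussian d) (f l)" for l
    by (rule integrable_bounded_prob[OF prob_space_std_gaussian]) (use assms in auto)
  then show "integrable (iid_gaussians d k) (\<lambda>x. \<Prod>l=1..k. f l (x l))"
    "(\<integral>x. (\<Prod>l=1..k. f l (x l)) \<partial>iid_gaussians d k) =
      (\<Prod>l=1..k. integral\<^sup>L (std_gaussian d) (f l))"
    unfolding iid_gaussians_def by (auto intro!: product_integrable_prod product_integral_prod)
qed

text \<open>The mixed terms are odd in the second patch, hence vanish for \<open>k \<ge> 2\<close>.\<close>

lemma has_bochner_integral_ws_net_mult:
  assumes "k \<ge> 2"
  shows "has_bochner_integral (iid_gaussians d k) (\<lambda>x. ws_net d k w x * ws_net d k v x)
    (erf_corr d w v + erf_corr d w v ^ k)"
proof -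
  let ?I = "iid_gaussians d k"
  let ?e = "\<lambda>w x. erf (dotp d w x)"
  note p1 = mult_le_one[OF abs_erf_le_1 abs_ge_zero abs_erf_le_1]
  have HB: "has_bochner_integral ?I (\<lambda>x. \<Prod>l=1..k. f l (x l)) (\<Prod>l=1..k. integral\<^sup>L (std_gaussian d) (f l))"
    if "\<And>l. f l \<in> borel_measurable (std_gaussian d)" "\<And>l x. \<bar>f l x\<bar> \<le> 1" for f :: "nat \<Rightarrow> (nat \<Rightarrow> real) \<Rightarrow> real"
    using integrable_prod_iid[OF that] integral_prod_iid[OF that] by (simp add: has_bochner_integral_iff)
  have corr: "(\<integral>x. ?e w x * ?e v x \<partial>std_gaussian d) = erf_corr d w v"
    by (simp add: integral_erf_mult erf_corr_def)
  have one: "(\<integral>x. 1 \<partial>std_gaussian d) = (1::real)"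
    using prob_space.prob_space[OF prob_space_std_gaussian[of d]] by simp
  have ins: "{1..k} = insert 1 (insert 2 {3..k})"
    using assms by auto
  have A: "has_bochner_integral ?I (\<lambda>x. ?e w (x 1) * ?e v (x 1)) (erf_corr d w v)"
  proof -
    \<comment> \<open>Padding with the constant 1 turns an expression in the first patch into a
      product over all patches, to which \<open>HB\<close> applies.\<close>
    let ?f = "\<lambda>l::nat. if l = 1 then (\<lambda>x. ?e w x * ?e v x) else (\<lambda>_. 1)"
    have "has_bochner_integral ?I (\<lambda>x. \<Prod>l=1..k. ?f l (x l)) (\<Prod>l=1..k. integral\<^sup>L (std_gaussian d) (?f l))"
      by (rule HB) (auto simp: abs_mult p1)
    moreover have "(\<Prod>l=1..k. ?f l (x l)) = ?e w (x 1) * ?e v (x 1)" for x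
    proof -
      have "(\<Prod>l\<in>{3..k}. ?f l (x l)) = 1" by (rule prod.neutral) auto
      then show ?thesis unfolding ins by simp
    qed
    moreover have "(\<Prod>l=1..k. integral\<^sup>L (std_gaussian d) (?f l)) = erf_corr d w v"
    proof -
      have "(\<Prod>l\<in>{3..k}. integral\<^sup>L (std_gaussian d) (?f l)) = 1"
        using one by (intro prod.neutral) auto
      then show ?thesis unfolding ins using one corr by simp
    qed
    ultimately show ?thesis by simp
  qed
  have B: "has_bochner_integral ?I (\<lambda>x. (\<Prod>l=1..k. ?e w (x l)) * (\<Prod>l=1..k. ?e v (x l))) (erf_corr d w v ^ k)"
    using HB[of "\<lambda>_ x. ?e w x * ?e v x"] by (simp add: abs_mult p1 prod.distrib corr)
  have C: "has_bochner_integral ?I (\<lambda>x. ?e w (x 1) * (\<Prod>l=1..k. ?e v (x l))) 0" for w v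
  proof -
    let ?f = "\<lambda>l::nat. if l = 1 then (\<lambda>x. ?e w x * ?e v x) else ?e v"
    have "has_bochner_integral ?I (\<lambda>x. \<Prod>l=1..k. ?f l (x l)) (\<Prod>l=1..k. integral\<^sup>L (std_gaussian d) (?f l))"
      by (rule HB) (auto simp: abs_mult p1 abs_erf_le_1)
    moreover have "(\<Prod>l=1..k. ?f l (x l)) = ?e w (x 1) * (\<Prod>l=1..k. ?e v (x l))" for x
    proof -
      have "(\<Prod>l\<in>{3..k}. ?f l (x l)) = (\<Prod>l\<in>{3..k}. ?e v (x l))" by (rule prod.cong) auto
      then show ?thesis unfolding ins by simp
    qed
    moreover have "(\<Prod>l=1..k. integral\<^sup>L (std_gaussian d) (?f l)) = 0"
      using assms by (intro prod_zero bexI[of _ 2]) (auto simp: integral_erf)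
    ultimately show ?thesis by (simp only:)
  qed
  have "(\<lambda>x. ws_net d k w x * ws_net d k v x) = (\<lambda>x. (?e w (x 1) * ?e v (x 1) +
      (\<Prod>l=1..k. ?e w (x l)) * (\<Prod>l=1..k. ?e v (x l))) +
      (?e w (x 1) * (\<Prod>l=1..k. ?e v (x l)) + ?e v (x 1) * (\<Prod>l=1..k. ?e w (x l))))"
    by (simp add: ws_net_def algebra_simps)
  then show ?thesis
    using has_bochner_integral_add[OF has_bochner_integral_add[OF A B] has_bochner_integral_add[OF C C]]
    by simp
qed

lemma ws_objective_eq:
  assumes "k \<ge> 2"
  shows "ws_objective d k u w =
    1 / 2 * (erf_corr d w w + erf_corr d w w ^ k) - (erf_corr d w u + erf_corr d w u ^ k) +
    1 / 2 * (erf_corr d u u + erf_corr d u u ^ k)"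
proof -
  note H = has_bochner_integral_ws_net_mult[OF assms, of d]
  have "(\<lambda>x. 1 / 2 * (ws_net d k w x - ws_net d k u x)\<^sup>2) =
      (\<lambda>x. 1 / 2 * (ws_net d k w x * ws_net d k w x) - ws_net d k w x * ws_net d k u x +
      1 / 2 * (ws_net d k u x * ws_net d k u x))"
    by (simp add: power2_eq_square algebra_simps)
  then show ?thesis
    unfolding ws_objective_def
    using has_bochner_integral_integral_eq[OF has_bochner_integral_add[OF has_bochner_integral_diff[OF
        has_bochner_integral_mult_right[OF H[of w w], of "1/2"] H[of w u]]
        has_bochner_integral_mult_right[OF H[of u u], of "1/2"]]]
    by (simp only:)
qed

subsection \<open>The gradient of the objective\<close>

text \<open>The objective sees w only through s = |w|^2 and c = w.u, with U = |u|^2 fixed.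
  \<open>diag_corr\<close> and \<open>cross_corr\<close> are \<open>erf_corr\<close> in these
  scalars.\<close>

definition diag_corr :: "real \<Rightarrow> real" where
  "diag_corr s = 2 / pi * arcsin (2 * s / (1 + 2 * s))"

definition cross_corr :: "real \<Rightarrow> real \<Rightarrow> real \<Rightarrow> real" where
  "cross_corr U s c = 2 / pi * arcsin (2 * c / sqrt ((1 + 2 * s) * (1 + 2 * U)))"

text \<open>\<open>pull\<close> and \<open>shrink\<close> are the coefficients in -grad F(w) =
  \<open>pull\<close> u - \<open>shrink\<close> w.\<close>

definition pull :: "nat \<Rightarrow> real \<Rightarrow> real \<Rightarrow> real \<Rightarrow> real" where
  "pull k U s c = (1 + real k * cross_corr U s c ^ (k - 1)) *
     (4 / pi / sqrt ((1 + 2 * s) * (1 + 2 * U) - 4 * c\<^sup>2))"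

text \<open>The first summand stems from the self-correlation, the second from the
  cross-correlation, whose normalisation also depends on |w|.\<close>

definition shrink :: "nat \<Rightarrow> real \<Rightarrow> real \<Rightarrow> real \<Rightarrow> real" where
  "shrink k U s c = (1 + real k * diag_corr s ^ (k - 1)) * (4 / pi / ((1 + 2 * s) * sqrt (1 + 4 * s))) +
     pull k U s c * (2 * c / (1 + 2 * s))"

lemma erf_corr_self: "erf_corr d w w = diag_corr (dotp d w w)"
  using dotp_self_nonneg[of d w] by (simp add: erf_corr_def diag_corr_def real_sqrt_mult)

lemma erf_corr_cross: "erf_corr d w u = cross_corr (dotp d u u) (dotp d w w) (dotp d w u)"
  by (simp add: erf_corr_def cross_corr_def)

lemma DERIV_diag_corr:
  assumes "s \<ge> 0"
  shows "(diag_corr has_real_derivative 4 / pi / ((1 + 2 * s) * sqrt (1 + 4 * s))) (at s)"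
proof -
  let ?q = "2 * s / (1 + 2 * s)"
  have q: "-1 < ?q" "?q < 1"
    using assms by (auto simp: field_simps)
  have "1 - ?q\<^sup>2 = ((1 + 2 * s)\<^sup>2 - (2 * s)\<^sup>2) / (1 + 2 * s)\<^sup>2"
    using assms by (simp add: power_divide diff_divide_distrib)
  also have "(1 + 2 * s)\<^sup>2 - (2 * s)\<^sup>2 = 1 + 4 * s"
    by (simp add: power2_eq_square algebra_simps)
  finally have "1 - ?q\<^sup>2 = (1 + 4 * s) / (1 + 2 * s)\<^sup>2" .
  then have r: "sqrt (1 - ?q\<^sup>2) = sqrt (1 + 4 * s) / (1 + 2 * s)"
    using assms by (simp add: real_sqrt_divide)
  have "((\<lambda>s. 2 * s / (1 + 2 * s)) has_real_derivative 2 / (1 + 2 * s)\<^sup>2) (at s)"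
    using assms by (auto intro!: derivative_eq_intros simp: field_simps power2_eq_square)
  from DERIV_cmult[OF DERIV_chain2[OF DERIV_arcsin[OF q] this], of "2 / pi"]
  show ?thesis
    unfolding diag_corr_def[abs_def] r
  proof (rule DERIV_cong)
    have *: "2 / pi * (inverse (q / r) * (2 / r\<^sup>2)) = 4 / pi / (r * q)" if "r > 0" for q r :: real
      using that by (simp add: field_simps power2_eq_square)
    show "2 / pi * (inverse (sqrt (1 + 4 * s) / (1 + 2 * s)) * (2 / (1 + 2 * s)\<^sup>2)) =
        4 / pi / ((1 + 2 * s) * sqrt (1 + 4 * s))"
      by (rule *) (use assms in simp)
  qed
qed

text \<open>Stated along an arbitrary curve (S, C), so that one chain rule serves all partial
  derivatives. The Cauchy-Schwarz hypothesis makes the discriminant positive, so the arcsine is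
  differentiable there.\<close>

lemma DERIV_cross_corr:
  assumes "(S has_real_derivative S') (at t)" "(C has_real_derivative C') (at t)"
    and "S t \<ge> 0" "U \<ge> 0" "(C t)\<^sup>2 \<le> S t * U"
  shows "((\<lambda>t. cross_corr U (S t) (C t)) has_real_derivative
    2 / pi / sqrt ((1 + 2 * S t) * (1 + 2 * U) - 4 * (C t)\<^sup>2) *
      (2 * C' - 2 * C t * S' / (1 + 2 * S t))) (at t)"
proof -
  define s c p where "s = S t" and "c = C t" and "p = (1 + 2 * s) * (1 + 2 * U)"
  note [simp] = s_def[symmetric] c_def[symmetric]
  have s: "s \<ge> 0" "U \<ge> 0" "c\<^sup>2 \<le> s * U" using assms by auto
  have p: "p > 0" using s by (auto simp: p_def intro!: mult_pos_pos)
  have D: "p - 4 * c\<^sup>2 > 0"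
    using s by (simp add: p_def algebra_simps)
  let ?q = "2 * c / sqrt p"
  have "1 - ?q\<^sup>2 = (p - 4 * c\<^sup>2) / p"
    using p by (simp add: power_divide field_simps)
  then have r: "sqrt (1 - ?q\<^sup>2) = sqrt (p - 4 * c\<^sup>2) / sqrt p" and "?q\<^sup>2 < 1"
    using p D by (simp_all add: real_sqrt_divide power_divide)
  then have "\<bar>?q\<bar> < 1"
    by (simp only: abs_square_less_1)
  then have q: "-1 < ?q" "?q < 1" by linarith+
  have S: "((\<lambda>t. (1 + 2 * S t) * (1 + 2 * U)) has_real_derivative 2 * S' * (1 + 2 * U)) (at t)"
    by (auto intro!: derivative_eq_intros assms)
  have "((\<lambda>t. sqrt ((1 + 2 * S t) * (1 + 2 * U))) has_real_derivative
      inverse (sqrt p) / 2 * (2 * S' * (1 + 2 * U))) (at t)"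
  proof (rule DERIV_chain2[OF _ S])
    show "(sqrt has_real_derivative inverse (sqrt p) / 2) (at ((1 + 2 * S t) * (1 + 2 * U)))"
      using DERIV_real_sqrt[OF p] by (simp add: p_def)
  qed
  from DERIV_divide[OF DERIV_cmult[OF assms(2), of 2] this]
  have "((\<lambda>t. 2 * C t / sqrt ((1 + 2 * S t) * (1 + 2 * U))) has_real_derivative
      (2 * C' * sqrt p - 2 * c * (inverse (sqrt p) / 2 * (2 * S' * (1 + 2 * U)))) / (sqrt p * sqrt p)) (at t)"
    using p s by (auto simp: p_def)
  also have "(2 * C' * sqrt p - 2 * c * (inverse (sqrt p) / 2 * (2 * S' * (1 + 2 * U)))) / (sqrt p * sqrt p) =
      (2 * C' - 2 * c * S' * ((1 + 2 * U) / p)) / sqrt p"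
    using p by (simp add: field_simps)
  also have "(1 + 2 * U) / p = 1 / (1 + 2 * s)"
    using s by (simp add: p_def)
  finally have Q: "((\<lambda>t. 2 * C t / sqrt ((1 + 2 * S t) * (1 + 2 * U))) has_real_derivative
      (2 * C' - 2 * c * S' * (1 / (1 + 2 * s))) / sqrt p) (at t)" .
  have "(arcsin has_real_derivative inverse (sqrt (1 - ?q\<^sup>2))) (at (2 * C t / sqrt ((1 + 2 * S t) * (1 + 2 * U))))"
    using DERIV_arcsin[OF q] by (simp add: p_def)
  from DERIV_cmult[OF DERIV_chain2[OF this Q], of "2 / pi"]
  show ?thesis
    unfolding cross_corr_def r
  proof (rule DERIV_cong)
    have "2 / pi * (inverse (E / P) * (x / P)) = 2 / pi / E * x" if "P > 0" for E P x :: real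
      using that by (simp add: field_simps)
    then show "2 / pi * (inverse (sqrt (p - 4 * c\<^sup>2) / sqrt p) *
        ((2 * C' - 2 * c * S' * (1 / (1 + 2 * s))) / sqrt p)) =
      2 / pi / sqrt ((1 + 2 * S t) * (1 + 2 * U) - 4 * (C t)\<^sup>2) * (2 * C' - 2 * C t * S' / (1 + 2 * S t))"
      unfolding s_def[symmetric] c_def[symmetric] p_def[symmetric] using p by simp
  qed
qed

lemma dotp_fun_upd:
  assumes "i < d"
  shows "dotp d (w(i := t)) u = dotp d w u + (t - w i) * u i"
proof -
  have "(\<Sum>j\<in>{..<d} - {i}. (w(i := t)) j * u j) = (\<Sum>j\<in>{..<d} - {i}. w j * u j)"
    by (rule sum.cong) auto
  then show ?thesis
    using assms by (simp add: dotp_def sum.remove[of "{..<d}" i] algebra_simps)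
qed

lemma dotp_fun_upd_self:
  assumes "i < d"
  shows "dotp d (w(i := t)) (w(i := t)) = dotp d w w + t\<^sup>2 - (w i)\<^sup>2"
  using assms
  by (simp add: dotp_fun_upd dotp_commute[of d w "w(i := t)"] power2_eq_square algebra_simps)

text \<open>Along coordinate i, |w|^2 is quadratic and w.u affine in the moving coordinate, with
  derivatives 2 w_i and u_i. The chain rule therefore gives a combination of w_i and u_i whose
  coefficients do not depend on i.\<close>

lemma grad_ws_objective:
  assumes k: "k \<ge> 2" and i: "i < d"
  shows "grad d (ws_objective d k u) w i =
    shrink k (dotp d u u) (dotp d w w) (dotp d w u) * w i -
    pull k (dotp d u u) (dotp d w w) (dotp d w u) * u i"
proof -
  define s c U where "s = dotp d w w" and "c = dotp d w u" and "U = dotp d u u"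
  have s: "s \<ge> 0" "U \<ge> 0" "c\<^sup>2 \<le> s * U"
    by (simp_all add: s_def U_def c_def dotp_self_nonneg Cauchy_Schwarz_dotp)
  define S C where "S t = s + t\<^sup>2 - (w i)\<^sup>2" and "C t = c + (t - w i) * u i" for t
  have at: "S (w i) = s" "C (w i) = c"
    by (simp_all add: S_def C_def)
  have dS: "(S has_real_derivative 2 * w i) (at (w i))"
    unfolding S_def[abs_def] by (auto intro!: derivative_eq_intros)
  have dC: "(C has_real_derivative u i) (at (w i))"
    unfolding C_def[abs_def] by (auto intro!: derivative_eq_intros)
  let ?A = "\<lambda>t. diag_corr (S t)" and ?B = "\<lambda>t. cross_corr U (S t) (C t)"
  let ?a = "4 / pi / ((1 + 2 * s) * sqrt (1 + 4 * s))"
  let ?b = "4 / pi / sqrt ((1 + 2 * s) * (1 + 2 * U) - 4 * c\<^sup>2)"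
  have dA: "(?A has_real_derivative ?a * (2 * w i)) (at (w i))"
    using DERIV_chain2[OF DERIV_diag_corr dS] s by (simp add: at)
  have dB: "(?B has_real_derivative ?b * (u i - w i * (2 * c / (1 + 2 * s)))) (at (w i))"
    by (rule DERIV_cong[OF DERIV_cross_corr[OF dS dC]]) (use s in \<open>simp_all add: at field_simps\<close>)
  have obj: "ws_objective d k u (w(i := t)) =
      1 / 2 * (?A t + ?A t ^ k) - (?B t + ?B t ^ k) + 1 / 2 * (diag_corr U + diag_corr U ^ k)" for t
    unfolding ws_objective_eq[OF k] erf_corr_self erf_corr_cross dotp_fun_upd_self[OF i]
    unfolding dotp_fun_upd[OF i]
    by (simp add: S_def C_def s_def c_def U_def)
  have dAk: "((\<lambda>t. ?A t ^ k) has_real_derivative real k * diag_corr s ^ (k - 1) * (?a * (2 * w i))) (at (w i))"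
    by (rule DERIV_cong[OF DERIV_power[OF dA]]) (simp add: at)
  have dBk: "((\<lambda>t. ?B t ^ k) has_real_derivative
      real k * cross_corr U s c ^ (k - 1) * (?b * (u i - w i * (2 * c / (1 + 2 * s))))) (at (w i))"
    by (rule DERIV_cong[OF DERIV_power[OF dB]]) (simp add: at)
  have dF: "((\<lambda>t. ws_objective d k u (w(i := t))) has_real_derivative
      1 / 2 * (?a * (2 * w i) + real k * diag_corr s ^ (k - 1) * (?a * (2 * w i))) -
      (?b * (u i - w i * (2 * c / (1 + 2 * s))) +
       real k * cross_corr U s c ^ (k - 1) * (?b * (u i - w i * (2 * c / (1 + 2 * s)))))) (at (w i))"
    unfolding obj
    by (rule DERIV_cong[OF DERIV_add[OF DERIV_diff[OF DERIV_cmult[OF DERIV_add[OF dA dAk]]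
      DERIV_add[OF dB dBk]] DERIV_const]]) simp
  have "grad d (ws_objective d k u) w i = deriv (\<lambda>t. ws_objective d k u (w(i := t))) (w i)"
    using i by (simp add: grad_def)
  also have "\<dots> = shrink k U s c * w i - pull k U s c * u i"
  proof -
    have "1 / 2 * (a * (2 * x) + m * (a * (2 * x))) - (b * (y - x * q) + n * (b * (y - x * q))) =
        ((1 + m) * a + (1 + n) * b * q) * x - (1 + n) * b * y" for a b m n q x y :: real
      by (simp add: algebra_simps)
    then show ?thesis
      unfolding DERIV_imp_deriv[OF dF] shrink_def pull_def .
  qed
  finally show ?thesis
    by (simp add: s_def U_def c_def)
qed

subsection \<open>Estimates for the gradient\<close>

lemma frac_le_cross: "(a :: real) / b \<le> x / y \<longleftrightarrow> a * y \<le> x * b" if "b > 0" "y > 0"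
  using that by (simp add: pos_divide_le_eq pos_le_divide_eq)

lemma arcsin_bounds:
  assumes "0 \<le> y" "y \<le> 1"
  shows "0 \<le> arcsin y" "arcsin y \<le> pi / 2"
proof -
  show "0 \<le> arcsin y" using assms by (intro arcsin_nonneg) auto
  show "arcsin y \<le> pi / 2" using assms arcsin_ubound[of y] by simp
qed

section \<open>Bounds on the half ball, with \<open>s\<close>, \<open>c\<close>, \<open>U\<close>
  standing for |w|^2, w.u and |u|^2\<close>

context
  fixes U s c :: real
  assumes U: "1 \<le> U" and s: "0 \<le> s" "s \<le> U" and c: "0 < c" and CS: "c\<^sup>2 \<le> s * U"
begin

lemma c_le_U: "c \<le> U"
proof -
  have "s * U \<le> U\<^sup>2"
    using U s by (simp add: power2_eq_square mult_right_mono)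
  then show ?thesis
    using CS U by (rule_tac power2_le_imp_le) auto
qed

lemma diag_corr_bounds: "0 \<le> diag_corr s" "diag_corr s \<le> 1"
proof -
  have "0 \<le> 2 * s / (1 + 2 * s)" "2 * s / (1 + 2 * s) \<le> 1"
    using s by auto
  then have "0 \<le> arcsin (2 * s / (1 + 2 * s))" "arcsin (2 * s / (1 + 2 * s)) \<le> pi / 2"
    by (blast intro: arcsin_bounds)+
  then show "0 \<le> diag_corr s" "diag_corr s \<le> 1"
    by (auto simp: diag_corr_def field_simps)
qed

lemma cross_arg_bounds:
  "0 \<le> 2 * c / sqrt ((1 + 2 * s) * (1 + 2 * U))" "2 * c / sqrt ((1 + 2 * s) * (1 + 2 * U)) \<le> 1"
proof -
  have "(2 * c)\<^sup>2 \<le> (1 + 2 * s) * (1 + 2 * U)"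
    using CS U s by (simp add: power_mult_distrib algebra_simps)
  then have "2 * c \<le> sqrt ((1 + 2 * s) * (1 + 2 * U))"
    by (rule real_le_rsqrt)
  then show "2 * c / sqrt ((1 + 2 * s) * (1 + 2 * U)) \<le> 1"
    using U s by (subst divide_le_eq_1_pos) auto
  show "0 \<le> 2 * c / sqrt ((1 + 2 * s) * (1 + 2 * U))"
    using U s c by simp
qed

lemma cross_corr_bounds: "0 \<le> cross_corr U s c" "cross_corr U s c \<le> 1"
proof -
  have "0 \<le> arcsin (2 * c / sqrt ((1 + 2 * s) * (1 + 2 * U)))"
    "arcsin (2 * c / sqrt ((1 + 2 * s) * (1 + 2 * U))) \<le> pi / 2"
    using arcsin_bounds[OF cross_arg_bounds] by blast+
  then show "0 \<le> cross_corr U s c" "cross_corr U s c \<le> 1"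
    by (auto simp: cross_corr_def field_simps)
qed

text \<open>The hypothesis compares the squares of the two arcsine arguments after clearing
  denominators. The conclusion serves to order the factors 1 + k y^(k - 1) for the two correlations
  y.\<close>

lemma diag_corr_le_cross_corr:
  assumes "s\<^sup>2 * (1 + 2 * U) \<le> c\<^sup>2 * (1 + 2 * s)"
  shows "diag_corr s \<le> cross_corr U s c"
proof -
  have "s\<^sup>2 / (1 + 2 * s)\<^sup>2 \<le> c\<^sup>2 / ((1 + 2 * s) * (1 + 2 * U))"
  proof -
    have "s\<^sup>2 * ((1 + 2 * s) * (1 + 2 * U)) \<le> c\<^sup>2 * (1 + 2 * s)\<^sup>2"
      using mult_right_mono[OF assms, of "1 + 2 * s"] s by (simp add: power2_eq_square mult_ac)
    then show ?thesis
      using U s by (intro frac_le_cross[THEN iffD2]) auto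
  qed
  then have "(2 * s / (1 + 2 * s))\<^sup>2 \<le> (2 * c / sqrt ((1 + 2 * s) * (1 + 2 * U)))\<^sup>2"
    using U s by (simp add: power_divide power_mult_distrib)
  then have "2 * s / (1 + 2 * s) \<le> 2 * c / sqrt ((1 + 2 * s) * (1 + 2 * U))"
    using cross_arg_bounds by (rule_tac power2_le_imp_le)
  moreover have "-1 \<le> 2 * s / (1 + 2 * s)"
    using s by (rule_tac order_trans[of "-1" 0]) auto
  ultimately have "arcsin (2 * s / (1 + 2 * s)) \<le> arcsin (2 * c / sqrt ((1 + 2 * s) * (1 + 2 * U)))"
    using cross_arg_bounds(2) by (rule_tac arcsin_le_arcsin)
  then show ?thesis
    unfolding diag_corr_def cross_corr_def by (rule mult_left_mono) simp
qed

text \<open>Isolates the Gram determinant s U - c^2 of w and u, which is nonnegative and measures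
  how far they are from parallel.\<close>

lemma discriminant_eq: "(1 + 2 * s) * (1 + 2 * U) - 4 * c\<^sup>2 = 1 + 2 * s + 2 * U + 4 * (s * U - c\<^sup>2)"
  by (simp add: algebra_simps)

lemma sqrt_discriminant_bounds:
  "1 \<le> sqrt ((1 + 2 * s) * (1 + 2 * U) - 4 * c\<^sup>2)"
  "sqrt ((1 + 2 * s) * (1 + 2 * U) - 4 * c\<^sup>2) \<le> 1 + 2 * U"
proof -
  show "1 \<le> sqrt ((1 + 2 * s) * (1 + 2 * U) - 4 * c\<^sup>2)"
    using U s CS by (simp add: discriminant_eq)
  have "(1 + 2 * s) * (1 + 2 * U) \<le> (1 + 2 * U)\<^sup>2"
    unfolding power2_eq_square using U s by (intro mult_right_mono) auto
  then have "(1 + 2 * s) * (1 + 2 * U) - 4 * c\<^sup>2 \<le> (1 + 2 * U)\<^sup>2"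
    using zero_le_power2[of c] by linarith
  then show "sqrt ((1 + 2 * s) * (1 + 2 * U) - 4 * c\<^sup>2) \<le> 1 + 2 * U"
    using U by (intro real_le_lsqrt) auto
qed

lemma four_over_pi: "1 \<le> 4 / pi" "4 / pi \<le> 2"
  using pi_less_4 pi_ge_two by (auto simp: field_simps)

lemma one_plus_power_bounds:
  assumes "0 \<le> y" "y \<le> 1"
  shows "1 \<le> 1 + real k * y ^ n" "1 + real k * y ^ n \<le> 1 + real k"
  using assms by (auto simp: power_le_one mult_left_le)

text \<open>The lower bound guarantees a minimal turn towards u in each step; the upper bound limits
  the second-order error of a step.\<close>

lemma pull_bounds: "1 / (1 + 2 * U) \<le> pull k U s c" "pull k U s c \<le> 2 * (1 + real k)"
proof -
  let ?D = "sqrt ((1 + 2 * s) * (1 + 2 * U) - 4 * c\<^sup>2)"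
  note B = one_plus_power_bounds[OF cross_corr_bounds, of k "k - 1"]
  have "1 / (1 + 2 * U) \<le> 4 / pi / ?D"
    using sqrt_discriminant_bounds four_over_pi U by (intro frac_le) auto
  then have "1 * (1 / (1 + 2 * U)) \<le> pull k U s c"
    unfolding pull_def using B U by (intro mult_mono) auto
  then show "1 / (1 + 2 * U) \<le> pull k U s c" by simp
  have "4 / pi / ?D \<le> 2 / 1"
    using sqrt_discriminant_bounds four_over_pi by (intro frac_le) auto
  then have "pull k U s c \<le> (1 + real k) * 2"
    unfolding pull_def using B sqrt_discriminant_bounds by (intro mult_mono) auto
  then show "pull k U s c \<le> 2 * (1 + real k)" by simp
qed

lemma pull_pos: "0 < pull k U s c"
  by (rule less_le_trans[OF _ pull_bounds(1)]) (use U in simp)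

text \<open>For small \<eta> these bounds keep the factor 1 - \<eta>\<beta> of w in a step between 0
  and 1.\<close>

lemma shrink_bounds: "0 \<le> shrink k U s c" "shrink k U s c \<le> 2 * (1 + real k) * (1 + 2 * U)"
proof -
  note A = one_plus_power_bounds[OF diag_corr_bounds, of k "k - 1"]
  have q: "1 \<le> (1 + 2 * s) * sqrt (1 + 4 * s)"
    using s mult_mono[of 1 "1 + 2 * s" 1 "sqrt (1 + 4 * s)"] by simp
  have "4 / pi / ((1 + 2 * s) * sqrt (1 + 4 * s)) \<le> 2 / 1"
    using q four_over_pi by (intro frac_le) auto
  then have 1: "(1 + real k * diag_corr s ^ (k - 1)) * (4 / pi / ((1 + 2 * s) * sqrt (1 + 4 * s))) \<le>
      (1 + real k) * 2"
    using A s by (intro mult_mono) auto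
  have "2 * c / (1 + 2 * s) \<le> 2 * U / 1"
    using c_le_U c s by (intro frac_le) auto
  then have 2: "pull k U s c * (2 * c / (1 + 2 * s)) \<le> 2 * (1 + real k) * (2 * U)"
    using pull_bounds(2)[of k] pull_pos[of k] c s U by (intro mult_mono) auto
  show "shrink k U s c \<le> 2 * (1 + real k) * (1 + 2 * U)"
    unfolding shrink_def using 1 2 by (simp add: algebra_simps)
  show "0 \<le> shrink k U s c"
    unfolding shrink_def
    using pull_pos[of k] diag_corr_bounds c s
    by (intro add_nonneg_nonneg mult_nonneg_nonneg divide_nonneg_nonneg zero_le_power) auto
qed

text \<open>The left side is the inner product of -grad F(w) and u - w. Merging the two
  \<open>pull\<close> terms produces the Gram determinant in the first numerator and leaves a
  comparison of two weighted quotients.\<close>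

lemma descent_inner_eq:
  "pull k U s c * (U - c) - shrink k U s c * (c - s) =
    4 / pi / (1 + 2 * s) * ((1 + real k * cross_corr U s c ^ (k - 1)) *
      ((U - c + 2 * (s * U - c\<^sup>2)) / sqrt (1 + 2 * s + 2 * U + 4 * (s * U - c\<^sup>2))) -
      (1 + real k * diag_corr s ^ (k - 1)) * ((c - s) / sqrt (1 + 4 * s)))"
proof -
  have p: "1 + 2 * s > 0" using s by simp
  have e: "U - c - 2 * c / (1 + 2 * s) * (c - s) = (U - c + 2 * (s * U - c\<^sup>2)) / (1 + 2 * s)"
    using p by (simp add: field_simps power2_eq_square)
  have "b * (P / D) * x - (a * (P / (q * r)) + b * (P / D) * y) * z =
      P / q * (b * ((x - y * z) * q / D) - a * (z / r))"
    if "q > 0" for a b P D q r x y z :: real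
  proof -
    have "P / q * (b * ((x - y * z) * q / D)) = b * (P / D) * (x - y * z)"
      "P / q * (a * (z / r)) = a * (P / (q * r)) * z"
      using that by simp_all
    moreover have "b * t * x - (v + b * t * y) * z = b * t * (x - y * z) - v * z" for t v :: real
      by (simp add: algebra_simps)
    ultimately show ?thesis
      by (simp only: right_diff_distrib[of "P / q"])
  qed
  note eq = this[OF p]
  have w: "(U - c - 2 * c / (1 + 2 * s) * (c - s)) * (1 + 2 * s) = U - c + 2 * (s * U - c\<^sup>2)"
    by (rule iffD1[OF nonzero_eq_divide_eq e]) (use p in simp)
  have "pull k U s c * (U - c) - shrink k U s c * (c - s) =
    4 / pi / (1 + 2 * s) * ((1 + real k * cross_corr U s c ^ (k - 1)) *
      ((U - c - 2 * c / (1 + 2 * s) * (c - s)) * (1 + 2 * s) /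
        sqrt (1 + 2 * s + 2 * U + 4 * (s * U - c\<^sup>2))) -
      (1 + real k * diag_corr s ^ (k - 1)) * ((c - s) / sqrt (1 + 4 * s)))"
    unfolding shrink_def pull_def discriminant_eq by (rule eq)
  then show ?thesis
    unfolding w .
qed

text \<open>Near the ray through \<open>u\<close> the comparison \<open>\<langle>-\<nabla>F(w), u - w\<rangle> > 0\<close> is essentially one-dimensional,
  except where \<open>diag_corr s > cross_corr U s c\<close>: there \<open>c - s\<close> is bounded by the
  Gram determinant \<open>s * U - c\<^sup>2\<close>, which is tiny.\<close>

lemma descent_inner_lower_bound:
  assumes far: "e\<^sup>2 \<le> U + s - 2 * c"
    and Q: "0 \<le> Q" "Q * (4 * (1 + 2 * U) * (1 + real k) * U\<^sup>2) \<le> e\<^sup>2"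
    and gram: "s * U - c\<^sup>2 \<le> Q * c\<^sup>2"
  shows "e\<^sup>2 / (4 * (1 + 4 * U) ^ 3) \<le> pull k U s c * (U - c) - shrink k U s c * (c - s)"
proof -
  define g where "g = s * U - c\<^sup>2"
  have g: "g \<ge> 0" using CS by (simp add: g_def)
  define b a where "b = 1 + real k * cross_corr U s c ^ (k - 1)"
    and "a = 1 + real k * diag_corr s ^ (k - 1)"
  have b: "b \<ge> 1" and a: "a \<ge> 1" "a \<le> 1 + real k"
    unfolding a_def b_def using one_plus_power_bounds[OF cross_corr_bounds]
      one_plus_power_bounds[OF diag_corr_bounds] by auto
  define D where "D = sqrt (1 + 2 * s + 2 * U + 4 * g)"
  have D: "1 \<le> D" "D \<le> 1 + 2 * U"
    using sqrt_discriminant_bounds by (simp_all add: D_def g_def discriminant_eq)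
  \<comment> \<open>The bracket in \<open>descent_inner_eq\<close> is b X - a Y, to be bounded below
    by m. Its prefactor is at least 1 / (1 + 4 U), which turns m into the claimed bound.\<close>
  define X Y where "X = (U - c + 2 * g) / D" and "Y = (c - s) / sqrt (1 + 4 * s)"
  define m where "m = e\<^sup>2 / (4 * (1 + 4 * U)\<^sup>2)"
  have m: "m \<ge> 0" by (simp add: m_def)
  \<comment> \<open>Since s <= U, the quantity 2 (U - c) is at least |w - u|^2.\<close>
  have Uc: "U - c \<ge> e\<^sup>2 / 2" using far s by simp
  have Uc0: "0 \<le> U - c" using Uc zero_le_power2[of e] by linarith
  have "e\<^sup>2 / 2 / (1 + 2 * U) \<le> X"
    unfolding X_def using Uc Uc0 g D by (intro frac_le) auto
  then have X: "e\<^sup>2 / 2 / (1 + 2 * U) \<le> b * X"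
    using b U mult_mono[of 1 b "e\<^sup>2 / 2 / (1 + 2 * U)" X] by simp
  have X0: "X \<ge> 0" unfolding X_def using Uc0 g D by (intro divide_nonneg_pos) auto
  have m_le: "m \<le> e\<^sup>2 / 4 / (1 + 2 * U)"
  proof -
    have "1 + 2 * U \<le> (1 + 4 * U)\<^sup>2"
      using U by (simp add: power2_eq_square algebra_simps)
    then have "e\<^sup>2 / (4 * (1 + 4 * U)\<^sup>2) \<le> e\<^sup>2 / (4 * (1 + 2 * U))"
      using U by (intro divide_left_mono) (auto intro!: mult_pos_pos)
    then show ?thesis by (simp add: m_def)
  qed
  have half: "e\<^sup>2 / 2 / (1 + 2 * U) = 2 * (e\<^sup>2 / 4 / (1 + 2 * U))" by (simp only: times_divide_eq_right)
  have pos4: "0 \<le> e\<^sup>2 / 4 / (1 + 2 * U)" using U by simp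
  have main: "m \<le> b * X - a * Y"
  proof -
    \<comment> \<open>If c <= s then Y <= 0. Otherwise the test of
      \<open>diag_corr_le_cross_corr\<close> separates the case where a may exceed b from the case
      where a <= b.\<close>
    consider "c \<le> s" | "s < c" "c\<^sup>2 * (1 + 2 * s) < s\<^sup>2 * (1 + 2 * U)"
      | "s < c" "s\<^sup>2 * (1 + 2 * U) \<le> c\<^sup>2 * (1 + 2 * s)"
      by linarith
    then show ?thesis
    proof cases
      case 1
      then have "Y \<le> 0" unfolding Y_def using s by (simp add: divide_nonpos_pos)
      then have "a * Y \<le> 0" using a by (simp add: mult_nonneg_nonpos)
      then show ?thesis using X m_le half pos4 by linarith
    next
      case 2
      \<comment> \<open>When the test fails, c - s is bounded by the Gram determinant: 2 s is
        replaced by the larger c + s, which then cancels.\<close>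
      have "(c - s) * (c + s) \<le> 2 * s * g"
        using 2(2) by (simp add: g_def power2_eq_square algebra_simps)
      also have "\<dots> \<le> (c + s) * g"
        using 2(1) g by (intro mult_right_mono) auto
      finally have "c - s \<le> g"
        using c s by (simp add: mult.commute mult_le_cancel_left)
      also have "g \<le> Q * c\<^sup>2" using gram by (simp add: g_def)
      also have "\<dots> \<le> Q * U\<^sup>2"
        using Q c c_le_U by (intro mult_left_mono power_mono) auto
      finally have cs: "c - s \<le> Q * U\<^sup>2" .
      have "Y \<le> (c - s) / 1"
        unfolding Y_def using 2 s by (intro divide_left_mono) auto
      then have "Y \<le> Q * U\<^sup>2" using cs by simp
      \<comment> \<open>The factor 1 + k in the bound on Q absorbs a, and the subtracted term uses
        at most half of the lower bound for b X.\<close>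
      then have "a * Y \<le> (1 + real k) * (Q * U\<^sup>2)"
        using a Q 2 s by (intro mult_mono) (auto simp: Y_def)
      also have "\<dots> \<le> e\<^sup>2 / 4 / (1 + 2 * U)"
        using Q(2) U by (simp add: field_simps)
      finally show ?thesis using X m_le half by linarith
    next
      case 3
      \<comment> \<open>Here r = |w| and R = |u|. Replacing c by r R, as if w were parallel to u,
        reduces the comparison to the radial gap h = R - r.\<close>
      define r R where "r = sqrt s" and "R = sqrt U"
      have r: "r \<ge> 0" "r\<^sup>2 = s" and R: "R \<ge> 1" "R\<^sup>2 = U" "r \<le> R"
        using s U by (auto simp: r_def R_def)
      have crR: "c \<le> r * R"
      proof (rule power2_le_imp_le)
        show "c\<^sup>2 \<le> (r * R)\<^sup>2"
          unfolding power_mult_distrib r(2) R(2) by (rule CS)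
      qed (use r R in simp)
      define h where "h = R - r"
      have h: "h \<ge> 0" using R by (simp add: h_def)
      have Rh: "R * h = U - r * R" and rh: "r * h = r * R - s" and hRr: "h * (R + r) = U - s"
        and hh: "h\<^sup>2 = U + s - 2 * c - 2 * (r * R - c)" and rRc: "(r * R - c) * (r * R + c) = g"
        unfolding r(2)[symmetric] R(2)[symmetric] g_def h_def
        by (simp_all add: power2_eq_square algebra_simps)
      \<comment> \<open>|w - u|^2 is h^2 + 2 (r R - c). The small Gram determinant makes the second
        term at most e^2 / 2, so at least e^2 / 2 is radial.\<close>
      have h2: "h\<^sup>2 \<ge> e\<^sup>2 / 2"
      proof -
        have "(r * R - c) * c \<le> (r * R - c) * (r * R + c)"
          using crR r R by (intro mult_left_mono) auto
        also have "\<dots> = g" by (rule rRc)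
        also have "g \<le> Q * c * c" using gram by (simp add: g_def power2_eq_square)
        finally have "r * R - c \<le> Q * c" using c by simp
        also have "\<dots> \<le> Q * U" using Q c_le_U by (intro mult_left_mono) auto
        also have "\<dots> \<le> e\<^sup>2 / 4"
        proof -
          have "1 * 1 * U \<le> (1 + 2 * U) * (1 + real k) * U\<^sup>2"
            using U by (intro mult_mono) (auto simp: power2_eq_square)
          then have "Q * U \<le> Q * ((1 + 2 * U) * (1 + real k) * U\<^sup>2)"
            using Q by (intro mult_left_mono) auto
          moreover have "Q * (4 * (1 + 2 * U) * (1 + real k) * U\<^sup>2) = 4 * (Q * ((1 + 2 * U) * (1 + real k) * U\<^sup>2))"
            by simp
          ultimately show ?thesis using Q(2) by linarith
        qed
        finally have "2 * (r * R - c) \<le> e\<^sup>2 / 2" by simp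
        then show ?thesis using far hh by linarith
      qed
      define y where "y = 1 + 2 * s + 2 * U"
      have y: "y \<ge> 1" "U \<le> y" "y \<le> 1 + 4 * U" using s U by (auto simp: y_def)
      \<comment> \<open>Dropping g from numerator and root only decreases the quotient, because U -
        c <= y.\<close>
      have "(U - c) / sqrt y \<le> X"
      proof -
        have "(U - c)\<^sup>2 * (y + 4 * g) \<le> (U - c + 2 * g)\<^sup>2 * y"
        proof -
          have "(U - c) * (U - c) * g \<le> (U - c) * y * g"
            using Uc0 y g c by (intro mult_right_mono mult_left_mono) auto
          moreover have "0 \<le> g * g * y" using g y by simp
          ultimately show ?thesis by (simp add: power2_eq_square algebra_simps)
        qed
        then have "sqrt ((U - c)\<^sup>2 * (y + 4 * g)) \<le> sqrt ((U - c + 2 * g)\<^sup>2 * y)"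
          by simp
        then have "(U - c) * D \<le> (U - c + 2 * g) * sqrt y"
          using g Uc0 by (simp add: real_sqrt_mult D_def y_def)
        then show ?thesis
          unfolding X_def using D y by (simp add: field_simps)
      qed
      moreover have "R * h / sqrt y \<le> (U - c) / sqrt y"
        using crR y unfolding Rh by (intro divide_right_mono) auto
      ultimately have Xh: "h * (R / sqrt y) \<le> X" by (simp add: mult_ac)
      have "Y \<le> r * h / sqrt (1 + 4 * s)"
        unfolding Y_def rh using crR s by (intro divide_right_mono) auto
      then have Yh: "Y \<le> h * (r / sqrt (1 + 4 * s))" by (simp add: mult_ac)
      \<comment> \<open>Now X >= h p and Y <= h q. Since p^2 - q^2 is a positive multiple of U - s =
        h (R + r), the difference X - Y is at least of order h^2.\<close>
      define p q where "p = R / sqrt y" and "q = r / sqrt (1 + 4 * s)"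
      have pq: "0 \<le> p" "p \<le> 1" "0 \<le> q" "q \<le> 1"
        using r R y s by (auto simp: p_def q_def r_def R_def)
      have "p\<^sup>2 - q\<^sup>2 = (U - s) * (1 + 2 * s) / (y * (1 + 4 * s))"
      proof -
        have "p\<^sup>2 - q\<^sup>2 = U / y - s / (1 + 4 * s)"
          using r R y s by (simp add: p_def q_def power_divide)
        also have "\<dots> = (U * (1 + 4 * s) - s * y) / (y * (1 + 4 * s))"
          using y s by (subst diff_frac_eq) auto
        also have "U * (1 + 4 * s) - s * y = (U - s) * (1 + 2 * s)"
          by (simp add: y_def algebra_simps)
        finally show ?thesis .
      qed
      moreover have "(U - s) * 1 / ((1 + 4 * U) * (1 + 4 * U)) \<le> (U - s) * (1 + 2 * s) / (y * (1 + 4 * s))"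
        using s U y by (intro frac_le mult_left_mono mult_mono mult_pos_pos) auto
      ultimately have pq2: "(U - s) / (1 + 4 * U)\<^sup>2 \<le> p\<^sup>2 - q\<^sup>2"
        by (simp add: power2_eq_square)
      have "h * 1 \<le> h * (R + r)"
        using h r R by (intro mult_left_mono) auto
      also have "\<dots> = U - s" by (rule hRr)
      finally have "h / (1 + 4 * U)\<^sup>2 \<le> (U - s) / (1 + 4 * U)\<^sup>2"
        by (intro divide_right_mono) auto
      then have hp: "h / (1 + 4 * U)\<^sup>2 \<le> p\<^sup>2 - q\<^sup>2" using pq2 by simp
      have "0 \<le> h / (1 + 4 * U)\<^sup>2" using h by simp
      then have "q\<^sup>2 \<le> p\<^sup>2" using hp by linarith
      then have "q \<le> p" using pq(1) by (rule power2_le_imp_le)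
      then have "(p - q) * (p + q) \<le> (p - q) * 2"
        using pq by (intro mult_left_mono) linarith+
      have "h / (1 + 4 * U)\<^sup>2 \<le> 2 * (p - q)"
      proof -
        have "p\<^sup>2 - q\<^sup>2 = (p - q) * (p + q)"
          by (simp add: power2_eq_square algebra_simps)
        then show ?thesis
          using hp \<open>(p - q) * (p + q) \<le> (p - q) * 2\<close> by linarith
      qed
      then have "h * (h / (1 + 4 * U)\<^sup>2) \<le> h * (2 * (p - q))"
        using h by (rule mult_left_mono)
      have "h\<^sup>2 / (1 + 4 * U)\<^sup>2 \<le> 2 * (X - Y)"
      proof -
        have "h * (2 * (p - q)) \<le> 2 * (X - Y)"
          using Xh Yh unfolding p_def[symmetric] q_def[symmetric] by (simp add: right_diff_distrib)
        with \<open>h * (h / (1 + 4 * U)\<^sup>2) \<le> h * (2 * (p - q))\<close>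
        have "h * (h / (1 + 4 * U)\<^sup>2) \<le> 2 * (X - Y)"
          by (rule order_trans)
        then show ?thesis
          by (simp add: power2_eq_square[of h])
      qed
      moreover have "e\<^sup>2 / 2 / (1 + 4 * U)\<^sup>2 \<le> h\<^sup>2 / (1 + 4 * U)\<^sup>2"
        using h2 by (intro divide_right_mono) auto
      ultimately have mXY: "m \<le> X - Y" by (simp add: m_def)
      \<comment> \<open>With a <= b and X >= 0 the bracket is at least a (X - Y), and a >=
        1.\<close>
      have "a \<le> b"
        unfolding a_def b_def using diag_corr_le_cross_corr[OF 3(2)] diag_corr_bounds
        by (auto intro!: mult_left_mono power_mono)
      then have "a * X \<le> b * X" using X0 by (rule mult_right_mono)
      moreover have "1 * m \<le> a * (X - Y)"
        using a m mXY by (intro mult_mono) auto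
      ultimately show ?thesis by (simp add: algebra_simps)
    qed
  qed
  have "1 / (1 + 4 * U) \<le> 4 / pi / (1 + 2 * s)"
    using four_over_pi s U by (intro frac_le) auto
  then have "1 / (1 + 4 * U) * m \<le> 4 / pi / (1 + 2 * s) * (b * X - a * Y)"
    using main m s U by (intro mult_mono) auto
  moreover have "1 / w * (E / (4 * w\<^sup>2)) = E / (4 * w ^ 3)" for E w :: real
    by (simp add: power2_eq_square power3_eq_cube)
  ultimately have "e\<^sup>2 / (4 * (1 + 4 * U) ^ 3) \<le> 4 / pi / (1 + 2 * s) * (b * X - a * Y)"
    by (simp only: m_def)
  then show ?thesis
    unfolding descent_inner_eq a_def b_def X_def Y_def D_def g_def .
qed

end

subsection \<open>Projected gradient steps\<close>

lemma dotp_cong: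
  "(\<And>i. i < d \<Longrightarrow> v i = v' i) \<Longrightarrow> (\<And>i. i < d \<Longrightarrow> w i = w' i) \<Longrightarrow> dotp d v w = dotp d v' w'"
  by (simp add: dotp_def)

lemma dotp_restrict_lincomb:
  "dotp d (\<lambda>i\<in>{..<d}. a * v i + b * w i) x = a * dotp d v x + b * dotp d w x"
  by (subst dotp_lincomb[symmetric]) (rule dotp_cong; simp)

lemma dotp_restrict_lincomb_self:
  "dotp d (\<lambda>i\<in>{..<d}. a * v i + b * w i) (\<lambda>i\<in>{..<d}. a * v i + b * w i) =
    a\<^sup>2 * dotp d v v + 2 * a * b * dotp d v w + b\<^sup>2 * dotp d w w"
  unfolding dotp_restrict_lincomb dotp_commute[of d _ "restrict _ _"]
  by (simp add: dotp_commute[of d w v] power2_eq_square algebra_simps)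

lemma dotp_restrict_scale:
  "dotp d (\<lambda>i\<in>{..<d}. r * a i) x = r * dotp d a x"
  "dotp d (\<lambda>i\<in>{..<d}. r * a i) (\<lambda>i\<in>{..<d}. r * a i) = r\<^sup>2 * dotp d a a"
  using dotp_restrict_lincomb[of d r a 0 a] dotp_restrict_lincomb_self[of d r a 0 a] by simp_all

lemma vnorm_eq: "vnorm d v = sqrt (dotp d v v)"
  by (simp add: vnorm_def L2_set_def dotp_def power2_eq_square)

lemma vdist_power2: "(vdist d v w)\<^sup>2 = dotp d v v - 2 * dotp d v w + dotp d w w"
proof -
  have "(\<lambda>i\<in>{..<d}. v i - w i) = (\<lambda>i\<in>{..<d}. 1 * v i + (- 1) * w i)"
    by (rule restrict_ext) simp
  then show ?thesis
    using dotp_self_nonneg[of d "\<lambda>i\<in>{..<d}. 1 * v i + (- 1) * w i"]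
    by (simp only: vdist_def vnorm_eq real_sqrt_pow2) (simp only: dotp_restrict_lincomb_self, simp)
qed

lemma vdist_nonneg: "0 \<le> vdist d v w"
  by (simp add: vdist_def vnorm_def)

lemma vdist_le_iff: "vdist d a v \<le> vdist d a y \<longleftrightarrow> (vdist d a v)\<^sup>2 \<le> (vdist d a y)\<^sup>2"
  by (simp add: vdist_nonneg)

lemma vdist_eq_0_imp_eq:
  assumes "v \<in> Rn d" "w \<in> Rn d" "vdist d v w = 0"
  shows "v = w"
proof (rule PiE_ext[OF assms(1,2)])
  fix i assume "i \<in> {..<d}"
  moreover have "\<forall>i\<in>{..<d}. (\<lambda>i\<in>{..<d}. v i - w i) i = 0"
    using assms(3) unfolding vdist_def vnorm_def by (subst (asm) L2_set_eq_0_iff) auto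
  ultimately show "v i = w i" by auto
qed

text \<open>The obtuse angle criterion, in a form that also yields that \<open>proj\<close> does not increase the
  distance to points of \<open>S\<close>.\<close>

lemma proj_eqI:
  assumes "S \<subseteq> Rn d" "v \<in> S"
    and obtuse: "\<And>y. y \<in> S \<Longrightarrow> (vdist d a v)\<^sup>2 + (vdist d v y)\<^sup>2 \<le> (vdist d a y)\<^sup>2"
  shows "proj d S a = v"
  unfolding proj_def
proof (rule some_equality)
  show "v \<in> S \<and> (\<forall>y\<in>S. vdist d a v \<le> vdist d a y)"
    unfolding vdist_le_iff using assms(2) obtuse
    by (metis add_increasing2 add_le_cancel_left le_add_same_cancel1 order_trans zero_le_power2)
next
  fix y assume y: "y \<in> S \<and> (\<forall>x\<in>S. vdist d a y \<le> vdist d a x)"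
  then have "(vdist d a y)\<^sup>2 \<le> (vdist d a v)\<^sup>2"
    using assms(2) unfolding vdist_le_iff by blast
  then have "(vdist d v y)\<^sup>2 \<le> 0"
    using obtuse[of y] y by linarith
  then have "vdist d v y = 0" by simp
  then show "y = v"
    using vdist_eq_0_imp_eq[of v d y] assms(1,2) y by auto
qed

text \<open>Projection onto the centred ball is a rescaling that brings |a| down to at most |u|;
  Cauchy-Schwarz yields the obtuse angle inequality. As u lies in the ball, the distance to u does
  not grow.\<close>

lemma proj_ball:
  assumes u: "u \<in> Rn d" and a: "a \<in> Rn d" and U: "0 < dotp d u u"
  obtains r where "0 < r" "r \<le> 1"
    "proj d {v \<in> Rn d. vnorm d v \<le> vnorm d u} a = (\<lambda>i\<in>{..<d}. r * a i)"
    "r\<^sup>2 * dotp d a a \<le> dotp d u u"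
    "(vdist d (\<lambda>i\<in>{..<d}. r * a i) u)\<^sup>2 \<le> (vdist d a u)\<^sup>2"
proof -
  let ?S = "{v \<in> Rn d. vnorm d v \<le> vnorm d u}"
  define R A where "R = vnorm d u" and "A = vnorm d a"
  have R: "R > 0" "dotp d u u = R\<^sup>2" and A: "A \<ge> 0" "dotp d a a = A\<^sup>2"
    using U by (auto simp: R_def A_def vnorm_eq dotp_self_nonneg)
  define r where "r = (if A \<le> R then 1 else R / A)"
  let ?v = "\<lambda>i\<in>{..<d}. r * a i"
  have l: "0 < r" "r \<le> 1" using R A by (auto simp: r_def)
  have lA: "r * A \<le> R" using R A by (auto simp: r_def)
  have vd: "dotp d ?v y = r * dotp d a y" "dotp d ?v ?v = r\<^sup>2 * dotp d a a" for y
    by (rule dotp_restrict_scale)+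
  have le: "r\<^sup>2 * dotp d a a \<le> dotp d u u"
    unfolding R(2) A(2) power_mult_distrib[symmetric] using lA l A by (intro power_mono) auto
  have obtuse: "(vdist d a ?v)\<^sup>2 + (vdist d ?v y)\<^sup>2 \<le> (vdist d a y)\<^sup>2" if "y \<in> ?S" for y
  proof -
    have y: "vnorm d y \<le> R" "0 \<le> vnorm d y" "dotp d y y = (vnorm d y)\<^sup>2"
      using that by (auto simp: R_def vnorm_eq dotp_self_nonneg)
    have "(dotp d a y)\<^sup>2 \<le> (A * vnorm d y)\<^sup>2"
      using Cauchy_Schwarz_dotp[of d a y] by (simp add: A y power_mult_distrib)
    then have "dotp d a y \<le> A * vnorm d y"
      by (rule power2_le_imp_le) (use A y in simp)
    also have "\<dots> \<le> A * R" using A y by (intro mult_left_mono) auto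
    finally have "(1 - r) * dotp d a y \<le> (1 - r) * (A * R)"
      using l by (intro mult_left_mono) auto
    \<comment> \<open>Either r = 1 and both sides vanish, or r A = R.\<close>
    also have "\<dots> = (1 - r) * (r * A\<^sup>2)"
      by (auto simp: r_def power2_eq_square)
    finally show ?thesis
      unfolding vdist_power2 dotp_commute[of d a ?v] vd A(2)
      by (simp add: algebra_simps power2_eq_square)
  qed
  have vS: "?v \<in> ?S"
    using le[folded vd(2)] by (simp add: vnorm_eq)
  have uS: "u \<in> ?S" using u by simp
  show thesis
  proof (rule that[of r])
    show "proj d ?S a = ?v"
      by (rule proj_eqI) (use vS obtuse in auto)
    show "(vdist d ?v u)\<^sup>2 \<le> (vdist d a u)\<^sup>2"
      using obtuse[OF uS] zero_le_power2[of "vdist d a ?v"] by linarith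
  qed (use l le in auto)
qed

text \<open>The gradient lies in the span of w and u, so a step forms (1 - \<eta>\<beta>) w +
  \<eta>\<alpha> u and scales it by r. The analysis thus reduces to the scalars s and c.\<close>

lemma pgd_step_scalars:
  fixes d u w k \<eta>
  defines "s \<equiv> dotp d w w" and "c \<equiv> dotp d w u" and "U \<equiv> dotp d u u"
  defines "\<alpha> \<equiv> pull k U s c" and "\<beta> \<equiv> shrink k U s c" and "w' \<equiv> pgd_step d k u \<eta> w"
  assumes k: "k \<ge> 2" and u: "u \<in> Rn d" and U: "0 < dotp d u u"
  obtains r where "0 < r" "r \<le> 1"
    "dotp d w' w' = r\<^sup>2 * ((1 - \<eta> * \<beta>)\<^sup>2 * s + 2 * (1 - \<eta> * \<beta>) * (\<eta> * \<alpha>) * c + (\<eta> * \<alpha>)\<^sup>2 * U)"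
    "dotp d w' u = r * ((1 - \<eta> * \<beta>) * c + \<eta> * \<alpha> * U)"
    "dotp d w' w' \<le> U"
    "(vdist d w' u)\<^sup>2 \<le> U + s - 2 * c - 2 * \<eta> * (\<alpha> * (U - c) - \<beta> * (c - s)) +
      \<eta>\<^sup>2 * (\<alpha>\<^sup>2 * U - 2 * \<alpha> * \<beta> * c + \<beta>\<^sup>2 * s)"
proof -
  define a where "a = (\<lambda>i\<in>{..<d}. w i - \<eta> * grad d (ws_objective d k u) w i)"
  have a: "a = (\<lambda>i\<in>{..<d}. (1 - \<eta> * \<beta>) * w i + \<eta> * \<alpha> * u i)"
    unfolding a_def
    by (rule restrict_ext)
      (simp add: grad_ws_objective[OF k] \<alpha>_def \<beta>_def s_def c_def U_def algebra_simps)
  have aR: "a \<in> Rn d" unfolding a_def by simp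
  have aa: "dotp d a a = (1 - \<eta> * \<beta>)\<^sup>2 * s + 2 * (1 - \<eta> * \<beta>) * (\<eta> * \<alpha>) * c + (\<eta> * \<alpha>)\<^sup>2 * U"
    and au: "dotp d a u = (1 - \<eta> * \<beta>) * c + \<eta> * \<alpha> * U"
    unfolding a s_def c_def U_def by (rule dotp_restrict_lincomb_self dotp_restrict_lincomb)+
  obtain r where l: "0 < r" "r \<le> 1"
    "proj d {v \<in> Rn d. vnorm d v \<le> vnorm d u} a = (\<lambda>i\<in>{..<d}. r * a i)"
    "r\<^sup>2 * dotp d a a \<le> dotp d u u"
    "(vdist d (\<lambda>i\<in>{..<d}. r * a i) u)\<^sup>2 \<le> (vdist d a u)\<^sup>2"
    by (rule proj_ball[OF u aR U])
  have w': "w' = (\<lambda>i\<in>{..<d}. r * a i)"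
    unfolding w'_def pgd_step_def a_def[symmetric] by (rule l(3))
  have ww: "dotp d w' w' = r\<^sup>2 * dotp d a a" and wu: "dotp d w' u = r * dotp d a u"
    unfolding w' by (rule dotp_restrict_scale)+
  show thesis
  proof (rule that[OF l(1,2)])
    show "dotp d w' w' \<le> U" using l(4) by (simp add: ww U_def)
    have "(vdist d w' u)\<^sup>2 \<le> (vdist d a u)\<^sup>2"
      using l(5) by (simp add: w')
    also have "\<dots> = U + s - 2 * c - 2 * \<eta> * (\<alpha> * (U - c) - \<beta> * (c - s)) +
        \<eta>\<^sup>2 * (\<alpha>\<^sup>2 * U - 2 * \<alpha> * \<beta> * c + \<beta>\<^sup>2 * s)"
      unfolding vdist_power2 aa au U_def[symmetric]
      by (simp add: power2_eq_square algebra_simps)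
    finally show "(vdist d w' u)\<^sup>2 \<le> \<dots>" .
  qed (simp_all add: ww wu aa au)
qed

section \<open>Convergence in two phases: turning, then descent\<close>

lemma pgd_Suc: "pgd d k u \<eta> w (Suc t) = pgd_step d k u \<eta> (pgd d k u \<eta> w t)"
  by (simp add: pgd_def)

text \<open>If all iterates up to T + N were farther than e from u, then from step T on the squared
  tangent of the angle to u would be at most Q, so that \<open>descent_inner_lower_bound\<close>
  applies with margin m. Each later step lowers the squared distance, at most 2 U at step T, by
  \<eta> m, and N such steps exhaust it.\<close>

lemma pgd_reaches_target:
  fixes d :: nat and u :: "nat \<Rightarrow> real" and e Q m L \<eta> :: real and T N :: nat
  defines "U \<equiv> dotp d u u"
  assumes k: "k \<ge> 2" and e: "0 < e" "e \<le> 1" and u: "u \<in> Rn d" and U: "1 \<le> U"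
    and w: "0 < dotp d w u" "dotp d w w \<le> U"
    and Q: "0 < Q" "Q \<le> 1" "Q * (4 * (1 + 2 * U) * (1 + real k) * U\<^sup>2) \<le> e\<^sup>2"
    and m: "m = e\<^sup>2 / (4 * (1 + 4 * U) ^ 3)"
    and L: "L = 2 * (1 + real k) * (1 + 2 * U)"
    and \<eta>: "\<eta> = m / (4 * L\<^sup>2 * U)"
    and T: "1 + 2 * U \<le> real T * (Q * \<eta>)" and N: "2 * U \<le> real N * (\<eta> * m)"
  shows "\<exists>t\<le>T + N. vdist d (pgd d k u \<eta> w t) u \<le> e"
proof (rule ccontr)
  assume "\<not> ?thesis"
  then have far: "e < vdist d (pgd d k u \<eta> w t) u" if "t \<le> T + N" for t
    using that by force
  define x s c where "x t = pgd d k u \<eta> w t" and "s t = dotp d (x t) (x t)"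
    and "c t = dotp d (x t) u" for t
  define g where "g t = s t * U - (c t)\<^sup>2" for t
  define D where "D t = U + s t - 2 * c t" for t
  have D: "D t = (vdist d (x t) u)\<^sup>2" for t
    by (simp add: D_def vdist_power2 s_def c_def U_def)
  have D_far: "e\<^sup>2 < D t" if "t \<le> T + N" for t
    unfolding D using far[OF that] e by (intro power_strict_mono) (auto simp: x_def)
  have s0: "0 \<le> s t" and g0: "0 \<le> g t" and CS: "(c t)\<^sup>2 \<le> s t * U" for t
    using Cauchy_Schwarz_dotp[of d "x t" u] by (simp_all add: g_def s_def c_def U_def dotp_self_nonneg)
  have m0: "0 < m" using e U by (simp add: m)
  have m1: "m \<le> 1"
  proof -
    have "e\<^sup>2 \<le> 1" using e by (simp add: power_le_one)
    moreover have "1 \<le> (1 + 4 * U) ^ 3" using U by (intro one_le_power) simp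
    ultimately have "e\<^sup>2 \<le> 4 * (1 + 4 * U) ^ 3" by linarith
    then show ?thesis using U by (simp add: m)
  qed
  have L1: "1 \<le> L"
  proof -
    have "1 * 1 \<le> (2 * (1 + real k)) * (1 + 2 * U)"
      using U by (intro mult_mono) auto
    then show ?thesis by (simp add: L)
  qed
  have eta0: "0 < \<eta>" using m0 L1 U by (simp add: \<eta>)
  \<comment> \<open>As \<open>shrink\<close> is at most L, this keeps 1 - \<eta>\<beta> positive, so
    that no step flips the component orthogonal to u.\<close>
  have etaL: "\<eta> * L < 1"
  proof -
    have "L * 1 \<le> L * (L * U)"
      using L1 U mult_mono[of 1 L 1 U] by (intro mult_left_mono) auto
    then have "m * L < 4 * L\<^sup>2 * U"
      using m0 m1 L1 mult_right_mono[of m 1 L] by (simp add: power2_eq_square)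
    then show ?thesis
      using L1 U by (simp add: \<eta> divide_less_eq)
  qed
  \<comment> \<open>\<eta> is chosen so that the bound on the second-order term is exactly half of
    \<eta> m.\<close>
  have eta_sq: "\<eta>\<^sup>2 * (2 * L\<^sup>2 * U) = \<eta> * m / 2"
    using L1 U by (simp add: \<eta> power2_eq_square)
  let ?a = "\<lambda>t. pull k U (s t) (c t)" and ?b = "\<lambda>t. shrink k U (s t) (c t)"
  \<comment> \<open>c / sqrt g is the cotangent of the angle to u. The third conjunct says that it
    is at least t times \<eta> / (1 + 2 U), written without division to allow g = 0.\<close>
  have step: "s (Suc t) \<le> U \<and> 0 < c (Suc t) \<and>
      real (Suc t) * (\<eta> / (1 + 2 * U)) * sqrt (g (Suc t)) \<le> c (Suc t) \<and>
      D (Suc t) \<le> D t - 2 * \<eta> * (?a t * (U - c t) - ?b t * (c t - s t)) + \<eta> * m / 2"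
    if IH: "s t \<le> U" "0 < c t" "real t * (\<eta> / (1 + 2 * U)) * sqrt (g t) \<le> c t" for t
  proof -
    note ctx = U s0[of t] IH(1,2) CS[of t]
    define \<alpha> \<beta> \<kappa> where "\<alpha> = ?a t" and "\<beta> = ?b t" and "\<kappa> = 1 - \<eta> * \<beta>"
    have \<alpha>: "1 / (1 + 2 * U) \<le> \<alpha>" "\<alpha> \<le> L" "0 < \<alpha>"
    proof -
      have "2 * (1 + real k) * 1 \<le> L"
        unfolding L using U by (intro mult_left_mono) auto
      then show "1 / (1 + 2 * U) \<le> \<alpha>" "\<alpha> \<le> L" "0 < \<alpha>"
        using pull_bounds[OF ctx, of k] pull_pos[OF ctx, of k] unfolding \<alpha>_def by linarith+
    qed
    have \<beta>: "0 \<le> \<beta>" "\<beta> \<le> L"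
      using shrink_bounds[OF ctx, of k] by (simp_all add: \<beta>_def L)
    have "\<eta> * \<beta> \<le> \<eta> * L" using \<beta> eta0 by (intro mult_left_mono) auto
    then have "\<eta> * \<beta> < 1" using etaL by linarith
    then have \<kappa>: "0 < \<kappa>" "\<kappa> \<le> 1" using \<beta> eta0 by (auto simp: \<kappa>_def)
    have xS: "x (Suc t) = pgd_step d k u \<eta> (x t)"
      by (simp add: x_def pgd_Suc)
    obtain r where r: "0 < r" "r \<le> 1"
      "s (Suc t) = r\<^sup>2 * (\<kappa>\<^sup>2 * s t + 2 * \<kappa> * (\<eta> * \<alpha>) * c t + (\<eta> * \<alpha>)\<^sup>2 * U)"
      "c (Suc t) = r * (\<kappa> * c t + \<eta> * \<alpha> * U)"
      "s (Suc t) \<le> U"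
      "(vdist d (x (Suc t)) u)\<^sup>2 \<le> U + s t - 2 * c t - 2 * \<eta> * (\<alpha> * (U - c t) - \<beta> * (c t - s t)) +
        \<eta>\<^sup>2 * (\<alpha>\<^sup>2 * U - 2 * \<alpha> * \<beta> * c t + \<beta>\<^sup>2 * s t)"
      using pgd_step_scalars[OF k u, where w="x t" and \<eta>=\<eta>, folded U_def xS,
        folded s_def c_def, folded \<alpha>_def \<beta>_def, folded \<kappa>_def] U by auto
    have pos: "0 < \<eta> * \<alpha> * U" using eta0 \<alpha> U by simp
    have c': "0 < c (Suc t)"
      unfolding r(4) by (intro mult_pos_pos[OF r(1)] add_pos_pos[OF mult_pos_pos pos] \<kappa>(1) IH(2))
    \<comment> \<open>Adding a multiple of u leaves the Gram determinant unchanged; only the two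
      scalings of w enter.\<close>
    have "g (Suc t) = (r * \<kappa>)\<^sup>2 * g t"
      unfolding g_def r(3,4) by (simp add: power2_eq_square algebra_simps)
    then have sg: "sqrt (g (Suc t)) = r * \<kappa> * sqrt (g t)"
      using r \<kappa> by (simp add: real_sqrt_mult)
    have "g t \<le> U\<^sup>2"
      using mult_right_mono[OF IH(1), of U] U zero_le_power2[of "c t"]
      unfolding g_def power2_eq_square[of U] by linarith
    then have gU: "sqrt (g t) \<le> U"
      using U by (intro real_le_lsqrt) auto
    have split: "(a + h) * (\<kappa> * G) = \<kappa> * (a * G) + h * (\<kappa> * G)" for a h G :: real
      by (simp add: algebra_simps)
    have "\<kappa> * sqrt (g t) \<le> 1 * U"
      using \<kappa> gU g0[of t] by (intro mult_mono) auto
    moreover have "\<eta> * (1 / (1 + 2 * U)) \<le> \<eta> * \<alpha>"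
      using \<alpha>(1) eta0 by (intro mult_left_mono) auto
    \<comment> \<open>The gain in c covers one further unit of cotangent growth, because sqrt g <= U
      and \<alpha> >= 1 / (1 + 2 U).\<close>
    ultimately have "(\<eta> / (1 + 2 * U)) * (\<kappa> * sqrt (g t)) \<le> (\<eta> * \<alpha>) * U"
      using eta0 U \<kappa> \<alpha> g0[of t] by (intro mult_mono) auto
    moreover have "\<kappa> * (real t * (\<eta> / (1 + 2 * U)) * sqrt (g t)) \<le> \<kappa> * c t"
      using IH(3) \<kappa> by (intro mult_left_mono) auto
    ultimately have "(real t * (\<eta> / (1 + 2 * U)) + \<eta> / (1 + 2 * U)) * (\<kappa> * sqrt (g t)) \<le> \<kappa> * c t + \<eta> * \<alpha> * U"
      unfolding split by linarith
    then have "r * ((real t * (\<eta> / (1 + 2 * U)) + \<eta> / (1 + 2 * U)) * (\<kappa> * sqrt (g t))) \<le> c (Suc t)"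
      unfolding r(4) using r(1) by (intro mult_left_mono) auto
    moreover have "real (Suc t) * (\<eta> / (1 + 2 * U)) * sqrt (g (Suc t)) =
        r * ((real t * (\<eta> / (1 + 2 * U)) + \<eta> / (1 + 2 * U)) * (\<kappa> * sqrt (g t)))"
      unfolding sg of_nat_Suc by (simp only: distrib_right mult_1_left mult_ac add_ac)
    ultimately have dir: "real (Suc t) * (\<eta> / (1 + 2 * U)) * sqrt (g (Suc t)) \<le> c (Suc t)"
      by simp
    have "\<alpha>\<^sup>2 * U - 2 * \<alpha> * \<beta> * c t + \<beta>\<^sup>2 * s t \<le> 2 * L\<^sup>2 * U"
    proof -
      have "\<alpha>\<^sup>2 * U \<le> L\<^sup>2 * U"
        using \<alpha> U by (intro mult_right_mono power_mono) auto
      moreover have "\<beta>\<^sup>2 * s t \<le> L\<^sup>2 * U"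
        using \<beta> U IH(1) s0[of t] by (intro mult_mono power_mono) auto
      moreover have "0 \<le> 2 * \<alpha> * \<beta> * c t" using \<alpha> \<beta> IH(2) by simp
      ultimately show ?thesis by linarith
    qed
    then have "\<eta>\<^sup>2 * (\<alpha>\<^sup>2 * U - 2 * \<alpha> * \<beta> * c t + \<beta>\<^sup>2 * s t) \<le> \<eta> * m / 2"
      unfolding eta_sq[symmetric] by (intro mult_left_mono) auto
    then have "D (Suc t) \<le> D t - 2 * \<eta> * (\<alpha> * (U - c t) - \<beta> * (c t - s t)) + \<eta> * m / 2"
      using r(6) unfolding D[of "Suc t"] unfolding D_def by linarith
    then show ?thesis
      using r(5) c' dir by (simp add: \<alpha>_def \<beta>_def)
  qed
  have inv: "s t \<le> U \<and> 0 < c t \<and> real t * (\<eta> / (1 + 2 * U)) * sqrt (g t) \<le> c t" for t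
  proof (induction t)
    case 0
    then show ?case using w by (simp add: s_def c_def x_def pgd_def)
  next
    case (Suc t)
    then show ?case using step[of t] by blast
  qed
  have descent: "D (Suc t) \<le> D t - \<eta> * m" if t: "T \<le> t" "t \<le> T + N" for t
  proof -
    note I = inv[of t]
    note ctx = U s0[of t] I[THEN conjunct1] I[THEN conjunct2, THEN conjunct1] CS[of t]
    \<comment> \<open>After T steps the cotangent is at least 1 / Q. Hence the squared tangent is at
      most Q^2, and Q <= 1 weakens this to Q.\<close>
    have "1 / Q \<le> real T * (\<eta> / (1 + 2 * U))"
      using T Q U by (simp add: field_simps)
    also have "\<dots> \<le> real t * (\<eta> / (1 + 2 * U))"
      using t eta0 U by (intro mult_right_mono) auto
    finally have "1 / Q * sqrt (g t) \<le> real t * (\<eta> / (1 + 2 * U)) * sqrt (g t)"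
      using g0[of t] by (intro mult_right_mono) auto
    then have "1 / Q * sqrt (g t) \<le> c t" using I by linarith
    then have "sqrt (g t) \<le> Q * c t" using Q by (simp add: field_simps)
    then have "(sqrt (g t))\<^sup>2 \<le> (Q * c t)\<^sup>2"
      using g0[of t] by (intro power_mono) auto
    also have "\<dots> \<le> Q * (c t)\<^sup>2"
      using Q by (simp add: power_mult_distrib power2_eq_square[of Q] mult_right_mono mult_le_one mult_left_le)
    finally have "s t * U - (c t)\<^sup>2 \<le> Q * (c t)\<^sup>2"
      using g0[of t] by (simp add: g_def)
    from descent_inner_lower_bound[OF ctx _ _ Q(3) this] D_far[OF t(2)] Q(1)
    have "m \<le> ?a t * (U - c t) - ?b t * (c t - s t)"
      by (simp add: m D_def)
    \<comment> \<open>The first-order gain is at least 2 \<eta> m and the second-order loss at most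
      \<eta> m / 2, so a net decrease of \<eta> m remains.\<close>
    then have "\<eta> * m \<le> \<eta> * (?a t * (U - c t) - ?b t * (c t - s t))"
      using eta0 by (intro mult_left_mono) auto
    moreover have "0 < \<eta> * m" using eta0 m0 by simp
    moreover have "D (Suc t) \<le> D t - 2 * \<eta> * (?a t * (U - c t) - ?b t * (c t - s t)) + \<eta> * m / 2"
      using step[of t] I by blast
    ultimately show ?thesis by linarith
  qed
  have "D (T + n) \<le> 2 * U - real n * (\<eta> * m)" if "n \<le> N" for n
    using that
  proof (induction n)
    case 0
    then show ?case using inv[of T] by (simp add: D_def)
  next
    case (Suc n)
    then show ?case using descent[of "T + n"] by (simp add: algebra_simps)
  qed
  from this[of N] have "D (T + N) \<le> 0" using N by simp
  moreover have "0 < D (T + N)"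
    using D_far[of "T + N"] zero_le_power2[of e] by linarith
  ultimately show False by simp
qed

section \<open>Choice of the constants and the polynomial bound\<close>

lemma eval2_monom: "eval2 (monom p n) a b = poly p b * a ^ n"
proof -
  have "[:a:] ^ n = [:a ^ n:]"
    by (induction n) (simp_all add: mult.commute)
  then show ?thesis
    by (simp add: eval2_def poly_monom)
qed

theorem theorem4:
  "\<exists>P :: real poly poly.
     \<forall>(k::nat) (\<epsilon>::real). k \<ge> 2 \<longrightarrow> \<epsilon> > 0 \<longrightarrow>
       (\<exists>\<eta>>0. \<forall>(d::nat) u w.
          d \<ge> 1 \<longrightarrow> u \<in> Rn d \<longrightarrow> w \<in> Rn d \<longrightarrow>
          (vnorm d u)\<^sup>2 = 12 / pi\<^sup>2 * (real k)\<^sup>2 \<longrightarrow>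
          dotp d w u > 0 \<longrightarrow> vnorm d w \<le> vnorm d u \<longrightarrow>
          (\<exists>T::nat. real T \<le> eval2 P (real k) (1 / \<epsilon>) \<and>
             vdist d (pgd d k u \<eta> w T) u \<le> \<epsilon>))"
proof (rule exI[of _ "monom (smult (5 * 10 ^ 12) ([:1, 1:] ^ 4)) 23"], intro allI impI)
  fix k :: nat and \<epsilon> :: real
  assume k: "k \<ge> 2" and \<epsilon>: "\<epsilon> > 0"
  define K where "K = real k"
  have K: "2 \<le> K" using k by (simp add: K_def)
  \<comment> \<open>Capping the accuracy at 1 gives Q <= 1 and suits the hypotheses of
    \<open>pgd_reaches_target\<close> for large \<epsilon>.\<close>
  define e where "e = min \<epsilon> 1"
  have e: "0 < e" "e \<le> 1" "e \<le> \<epsilon>" using \<epsilon> by (auto simp: e_def)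
  \<comment> \<open>This is |u|^2 for every admissible u and depends on k only. Hence \<eta>, T and
    N are fixed by k and \<epsilon> before d, u and w are chosen.\<close>
  define U where "U = 12 / pi\<^sup>2 * K\<^sup>2"
  have pi: "2\<^sup>2 \<le> pi\<^sup>2" "pi\<^sup>2 \<le> 4\<^sup>2"
    using pi_ge_two pi_less_4 by (intro power_mono; simp)+
  have K2: "2\<^sup>2 \<le> K\<^sup>2" using K by (intro power_mono) auto
  have "12 / 4\<^sup>2 * 2\<^sup>2 \<le> U"
    unfolding U_def using pi K2 by (intro mult_mono divide_left_mono) auto
  then have U1: "1 \<le> U" by simp
  have "12 / pi\<^sup>2 * K\<^sup>2 \<le> 12 / 2\<^sup>2 * K\<^sup>2"
    using pi by (intro mult_right_mono divide_left_mono) auto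
  then have U3: "U \<le> 3 * K\<^sup>2" by (simp add: U_def)
  define L where "L = 2 * (1 + real k) * (1 + 2 * U)"
  define m where "m = e\<^sup>2 / (4 * (1 + 4 * U) ^ 3)"
  define q where "q = 4 * (1 + 2 * U) * (1 + real k) * U\<^sup>2"
  \<comment> \<open>The largest angle tolerance that \<open>pgd_reaches_target\<close>
    admits.\<close>
  define Q where "Q = e\<^sup>2 / q"
  define \<eta> where "\<eta> = m / (4 * L\<^sup>2 * U)"
  have q: "1 \<le> q"
  proof -
    have "1 * 1 * 1 \<le> (4 * (1 + 2 * U)) * (1 + real k) * U\<^sup>2"
      using U1 by (intro mult_mono) auto
    then show ?thesis by (simp add: q_def)
  qed
  have L0: "0 < L" using U1 by (simp add: L_def)
  have m0: "0 < m" using e U1 by (simp add: m_def)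
  have eta0: "0 < \<eta>" using m0 L0 U1 by (simp add: \<eta>_def)
  have e2: "e\<^sup>2 \<le> 1" using e by (simp add: power_le_one)
  have Q: "0 < Q" "Q \<le> 1" "Q * q \<le> e\<^sup>2"
    using q e e2 by (auto simp: Q_def)
  define T where "T = nat \<lceil>(1 + 2 * U) / (Q * \<eta>)\<rceil>"
  define N where "N = nat \<lceil>2 * U / (\<eta> * m)\<rceil>"
  have TN: "(1 + 2 * U) / (Q * \<eta>) \<le> real T" "2 * U / (\<eta> * m) \<le> real N"
    by (auto simp: T_def N_def intro: real_nat_ceiling_ge)
  have T: "1 + 2 * U \<le> real T * (Q * \<eta>)" and N: "2 * U \<le> real N * (\<eta> * m)"
    using TN Q eta0 m0 by (simp_all add: pos_divide_le_eq)
  \<comment> \<open>1 + 1 / \<epsilon> dominates 1 / e in both cases of the minimum, so X is a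
    polynomial substitute for 1 / e^2.\<close>
  define X where "X = (1 + 1 / \<epsilon>)\<^sup>2"
  have X: "1 / e\<^sup>2 \<le> X" "1 \<le> X"
  proof -
    have "1 / e \<le> 1 + 1 / \<epsilon>"
      using \<epsilon> by (auto simp: e_def min_def)
    then have "(1 / e)\<^sup>2 \<le> X"
      unfolding X_def using e by (intro power_mono) auto
    then show "1 / e\<^sup>2 \<le> X" by (simp add: power_divide)
    show "1 \<le> X" unfolding X_def using \<epsilon> by (intro one_le_power) simp
  qed
  \<comment> \<open>The exponents of K add up to 2 + 7 + 14 = 23 for T and 2 + 14 + 6 = 22 for N.
    The bounds for 1 / Q, 1 / \<eta> and 1 / m carry one factor X each, and two of them enter each
    count. The coefficient exceeds the sum of both constants plus 2 for rounding up.\<close>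
  have size: "real (T + N) \<le> 5 * 10 ^ 12 * K ^ 23 * X\<^sup>2"
  proof -
    have b1: "1 + 2 * U \<le> 7 * K\<^sup>2" and b2: "1 + 4 * U \<le> 13 * K\<^sup>2"
      using U3 K2 by simp_all
    have b3: "1 + real k \<le> 2 * K" using K by (simp add: K_def)
    have "L \<le> 2 * (2 * K) * (7 * K\<^sup>2)"
      unfolding L_def using b1 b3 U1 K by (intro mult_mono) auto
    then have bL: "L \<le> 28 * K ^ 3" by (simp add: power2_eq_square power3_eq_cube)
    have "q \<le> 4 * (7 * K\<^sup>2) * (2 * K) * (3 * K\<^sup>2)\<^sup>2"
      unfolding q_def using b1 b3 U1 U3 K by (intro mult_mono power_mono) auto
    then have "q \<le> 504 * K ^ 7" by (simp add: power_mult_distrib eval_nat_numeral mult_ac)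
    then have "q * (1 / e\<^sup>2) \<le> 504 * K ^ 7 * X"
      using X K by (intro mult_mono) auto
    then have bQ: "1 / Q \<le> 504 * K ^ 7 * X" by (simp add: Q_def)
    have "4 * (1 + 4 * U) ^ 3 \<le> 4 * (13 * K\<^sup>2) ^ 3"
      using b2 U1 by (intro mult_left_mono power_mono) auto
    then have "4 * (1 + 4 * U) ^ 3 \<le> 8788 * K ^ 6"
      by (simp add: power_mult_distrib power_mult[symmetric])
    then have "4 * (1 + 4 * U) ^ 3 * (1 / e\<^sup>2) \<le> 8788 * K ^ 6 * X"
      by (rule mult_mono[OF _ X(1)]) (use K in auto)
    then have bm: "1 / m \<le> 8788 * K ^ 6 * X" by (simp add: m_def)
    have "4 * L\<^sup>2 * U \<le> 4 * (28 * K ^ 3)\<^sup>2 * (3 * K\<^sup>2)"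
      using bL L0 U3 U1 K by (intro mult_mono power_mono) auto
    then have "4 * L\<^sup>2 * U \<le> 9408 * K ^ 8"
      by (simp add: power_mult_distrib power_mult[symmetric] power_add[symmetric])
    then have "4 * L\<^sup>2 * U * (1 / m) \<le> 9408 * K ^ 8 * (8788 * K ^ 6 * X)"
      by (rule mult_mono[OF _ bm]) (use m0 K in auto)
    moreover have "4 * L\<^sup>2 * U * (1 / m) = 1 / \<eta>" by (simp add: \<eta>_def)
    ultimately have b\<eta>: "1 / \<eta> \<le> 82677504 * K ^ 14 * X"
      by (simp add: power_add[symmetric])
    have "(1 + 2 * U) * (1 / Q) * (1 / \<eta>) \<le> 7 * K\<^sup>2 * (504 * K ^ 7 * X) * (82677504 * K ^ 14 * X)"
      using b1 bQ b\<eta> U1 Q eta0 K X by (intro mult_mono) auto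
    also have "\<dots> = 291686234112 * K ^ 23 * X\<^sup>2"
      by (simp add: eval_nat_numeral mult_ac)
    finally have bT: "(1 + 2 * U) / (Q * \<eta>) \<le> 291686234112 * K ^ 23 * X\<^sup>2"
      by simp
    have "(2 * U) * (1 / \<eta>) * (1 / m) \<le> (2 * (3 * K\<^sup>2)) * (82677504 * K ^ 14 * X) * (8788 * K ^ 6 * X)"
      using U3 bm b\<eta> U1 m0 eta0 K X by (intro mult_mono) auto
    also have "\<dots> = 4359419430912 * K ^ 22 * X\<^sup>2"
      by (simp add: eval_nat_numeral mult_ac)
    also have "\<dots> \<le> 4359419430912 * K ^ 23 * X\<^sup>2"
      using K by (intro mult_right_mono mult_left_mono power_increasing) auto
    finally have bN: "2 * U / (\<eta> * m) \<le> 4359419430912 * K ^ 23 * X\<^sup>2"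
      by simp
    have "1 * 1 \<le> K ^ 23 * X\<^sup>2"
      using K X by (intro mult_mono one_le_power) auto
    moreover have "real T \<le> (1 + 2 * U) / (Q * \<eta>) + 1" "real N \<le> 2 * U / (\<eta> * m) + 1"
      unfolding T_def N_def using U1 Q eta0 m0
      by (auto intro!: of_nat_ceiling)
    ultimately show ?thesis
      using bT bN by simp
  qed
  show "\<exists>\<eta>>0. \<forall>(d::nat) u w.
      d \<ge> 1 \<longrightarrow> u \<in> Rn d \<longrightarrow> w \<in> Rn d \<longrightarrow>
      (vnorm d u)\<^sup>2 = 12 / pi\<^sup>2 * (real k)\<^sup>2 \<longrightarrow>
      dotp d w u > 0 \<longrightarrow> vnorm d w \<le> vnorm d u \<longrightarrow>
      (\<exists>T::nat. real T \<le> eval2 (monom (smult (5 * 10 ^ 12) ([:1, 1:] ^ 4)) 23) (real k) (1 / \<epsilon>) \<and>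
         vdist d (pgd d k u \<eta> w T) u \<le> \<epsilon>)"
  proof (intro exI[of _ \<eta>] conjI allI impI)
    fix d :: nat and u w :: "nat \<Rightarrow> real"
    assume u: "u \<in> Rn d" and norm: "(vnorm d u)\<^sup>2 = 12 / pi\<^sup>2 * (real k)\<^sup>2"
      and w: "dotp d w u > 0" "vnorm d w \<le> vnorm d u"
    have Uu: "dotp d u u = U"
      using norm by (simp add: vnorm_eq dotp_self_nonneg U_def K_def)
    have "dotp d w w \<le> U"
      using w(2) by (simp add: vnorm_eq Uu)
    then have "\<exists>t\<le>T + N. vdist d (pgd d k u \<eta> w t) u \<le> e"
      using pgd_reaches_target[of k e u d w Q m L \<eta> T N] k e u U1 w Q m_def L_def \<eta>_def T N
      unfolding Uu q_def by blast
    then obtain t where "t \<le> T + N" "vdist d (pgd d k u \<eta> w t) u \<le> e" by blast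
    moreover have "eval2 (monom (smult (5 * 10 ^ 12) ([:1, 1:] ^ 4)) 23) (real k) (1 / \<epsilon>) =
        5 * 10 ^ 12 * K ^ 23 * X\<^sup>2"
      by (simp add: eval2_monom poly_power X_def K_def power_mult[symmetric])
    ultimately show "\<exists>T::nat. real T \<le>
        eval2 (monom (smult (5 * 10 ^ 12) ([:1, 1:] ^ 4)) 23) (real k) (1 / \<epsilon>) \<and>
        vdist d (pgd d k u \<eta> w T) u \<le> \<epsilon>"
      using size e(3) by (intro exI[of _ t]) auto
  qed (rule eta0)
qed

end
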